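(* Let $d\geq 2$ be any fixed dimension and let $\mathcal G\subset \mathrm{SU}(d)$ be any finite gate set which densely generates $\mathrm{SU}(d)$ (no closure under inverses is assumed). Then there is an efficient algorithm which, given any unitary $U\in \mathrm{SU}(d)$ and any accuracy $\epsilon>0$ (small), outputs a sequence $g_1,\dots,g_\ell$ of elements of $\mathcal G$ with $$\| g_1 g_2\cdots g_\ell - U\| \le \epsilon ,\qquad \ell = O\left(\mathrm{polylog}(\epsilon^{-1})\right).$$
   Context: $\|\cdot\|$ is the operator norm, $\|A\|=\sup_{\langle\psi|\psi\rangle=1}\|A|\psi\rangle\|_2$. A gate set $\mathcal G$ densely generates $\mathrm{SU}(d)$ (is universal) if the set of all finite products of elements of $\mathcal G$ (repetitions allowed, inverses of elements not allowed unless they themselves lie in $\mathcal G$) is dense in $\mathrm{SU}(d)$. $O(\mathrm{polylog}(\epsilon^{-1}))$ means: bounded by $C\log^{c}(\epsilon^{-1})$ for all sufficiently small $\epsilon$, with $C,c$ depending only on $d$ and $\mathcal G$ and not on $U$ or $\epsilon$. "Efficient" means that, for fixed $d$ and $\mathcal G$, the running time is polylogarithmic in $\epsilon^{-1}$, in the cost model where classical linear-algebra operations on $d\times d$ matrices cost $O(1)$ and where a fixed finite $\epsilon_0$-net of $\mathrm{SU}(d)$ consisting of products of elements of $\mathcal G$ (with $\epsilon_0>0$ a constant depending only on $d$) can be queried as an oracle. *)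

theory Defs
  imports "HOL-Analysis.Analysis"
begin

type_synonym 'n cmat = "complex^'n^'n"

definition conj_transpose :: "'n::finite cmat \<Rightarrow> 'n cmat" where
  "conj_transpose A = (\<chi> i j. cnj (A $ j $ i))"

definition unitary_mat :: "'n::finite cmat \<Rightarrow> bool" where
  "unitary_mat A \<longleftrightarrow> conj_transpose A ** A = mat 1 \<and> A ** conj_transpose A = mat 1"

definition SU :: "'n::finite cmat set" where
  "SU = {A. unitary_mat A \<and> det A = 1}"

definition op_norm :: "'n::finite cmat \<Rightarrow> real" where
  "op_norm A = onorm (\<lambda>x. A *v x)"

definition word_prod :: "'n::finite cmat list \<Rightarrow> 'n cmat" where
  "word_prod w = foldr (**) w (mat 1)"

definition densely_generates_SU :: "'n::finite cmat set \<Rightarrow> bool" where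
  "densely_generates_SU G \<longleftrightarrow> SU \<subseteq> closure (word_prod ` lists G)"

text \<open>
  A finite net is represented by the gate words spelling its elements, since a query
  has to return the word and not just its product.
\<close>

definition word_net :: "real \<Rightarrow> 'n::finite cmat set \<Rightarrow> 'n cmat list set \<Rightarrow> bool" where
  "word_net \<delta> G N \<longleftrightarrow>
     finite N \<and> N \<subseteq> lists G \<and> (\<forall>U\<in>SU. \<exists>w\<in>N. op_norm (word_prod w - U) \<le> \<delta>)"

definition net_oracle :: "real \<Rightarrow> 'n::finite cmat list set \<Rightarrow> ('n cmat \<Rightarrow> 'n cmat list) \<Rightarrow> bool" where
  "net_oracle \<delta> N orc \<longleftrightarrow>
     (\<forall>U. orc U \<in> N) \<and> (\<forall>U\<in>SU. op_norm (word_prod (orc U) - U) \<le> \<delta>)"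


subsection \<open>The cost model\<close>

text \<open>
  Algorithms are finite programs with recursive procedures, over registers that hold
  \<open>d \<times> d\<close> matrices, complex scalars and gate words.  Each matrix or scalar operation,
  each test and each oracle query costs 1; writing a word costs its length in addition,
  and so does multiplying out a word.

  Two restrictions keep the unit cost from being abused.  The only numerical literals are
  integers and the imaginary unit, because an arbitrary complex literal could hold a lookup
  table for all accuracies.  There are no exponentials, logarithms or rounding operations,
  because with them unit-cost arithmetic could read out such tables digit by digit.
\<close>

definition normal_mat :: "'n::finite cmat \<Rightarrow> bool" where
  "normal_mat A \<longleftrightarrow> A ** conj_transpose A = conj_transpose A ** A"

definition diagonal_mat :: "'n::finite cmat \<Rightarrow> bool" where
  "diagonal_mat A \<longleftrightarrow> (\<forall>i j. i \<noteq> j \<longrightarrow> A $ i $ j = 0)"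

text \<open>Spectral decomposition: unitary eigenvector matrix and diagonal eigenvalue matrix.\<close>

definition eigen_decomp :: "'n::finite cmat \<Rightarrow> 'n cmat \<times> 'n cmat" where
  "eigen_decomp A =
     (if normal_mat A
      then SOME (V, D). unitary_mat V \<and> diagonal_mat D \<and> A = V ** D ** conj_transpose V
      else (0, 0))"

datatype 'n mexp =
    MReg nat
  | MUnit 'n 'n
  | MAdd "'n mexp" "'n mexp"
  | MMul "'n mexp" "'n mexp"
  | MScale "'n sexp" "'n mexp"
  | MAdj "'n mexp"
  | MInv "'n mexp"
  | MEigvecs "'n mexp"
  | MEigvals "'n mexp"
and 'n sexp =
    SReg nat
  | SInt int
  | SImag
  | SAdd "'n sexp" "'n sexp"
  | SMul "'n sexp" "'n sexp"
  | SInv "'n sexp"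
  | SCnj "'n sexp"
  | SSqrt "'n sexp"
  | SEntry "'n mexp" 'n 'n
  | STrace "'n mexp"
  | SDet "'n mexp"
  | SNorm "'n mexp"

datatype ('n, gates: 'g) com =
    Skip
  | SetM nat "'n mexp"
  | SetS nat "'n sexp"
  | SetW nat "'g list"
  | Copy nat nat
  | Append nat nat nat
  | Multiply_Out nat nat
  | Query nat "'n mexp"
  | Seq "('n, 'g) com" "('n, 'g) com"
  | If_Le "'n sexp" "'n sexp" "('n, 'g) com" "('n, 'g) com"
  | While_Le "'n sexp" "'n sexp" "('n, 'g) com"
  | Call nat

record 'n state =
  mreg :: "nat \<Rightarrow> 'n cmat"
  sreg :: "nat \<Rightarrow> complex"
  wreg :: "nat \<Rightarrow> 'n cmat list"

primrec mval :: "'n::finite mexp \<Rightarrow> 'n state \<Rightarrow> 'n cmat"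
  and sval :: "'n::finite sexp \<Rightarrow> 'n state \<Rightarrow> complex" where
  "mval (MReg r) s = mreg s r"
| "mval (MUnit i j) s = (\<chi> k l. if k = i \<and> l = j then 1 else 0)"
| "mval (MAdd a b) s = mval a s + mval b s"
| "mval (MMul a b) s = mval a s ** mval b s"
| "mval (MScale x a) s = (\<chi> k l. sval x s * mval a s $ k $ l)"
| "mval (MAdj a) s = conj_transpose (mval a s)"
| "mval (MInv a) s = matrix_inv (mval a s)"
| "mval (MEigvecs a) s = fst (eigen_decomp (mval a s))"
| "mval (MEigvals a) s = snd (eigen_decomp (mval a s))"
| "sval (SReg r) s = sreg s r"
| "sval (SInt k) s = of_int k"
| "sval SImag s = \<i>"
| "sval (SAdd x y) s = sval x s + sval y s"
| "sval (SMul x y) s = sval x s * sval y s"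
| "sval (SInv x) s = inverse (sval x s)"
| "sval (SCnj x) s = cnj (sval x s)"
| "sval (SSqrt x) s = csqrt (sval x s)"
| "sval (SEntry a i j) s = mval a s $ i $ j"
| "sval (STrace a) s = trace (mval a s)"
| "sval (SDet a) s = det (mval a s)"
| "sval (SNorm a) s = of_real (op_norm (mval a s))"

primrec mcost :: "'n mexp \<Rightarrow> nat" and scost :: "'n sexp \<Rightarrow> nat" where
  "mcost (MReg r) = 1"
| "mcost (MUnit i j) = 1"
| "mcost (MAdd a b) = mcost a + mcost b + 1"
| "mcost (MMul a b) = mcost a + mcost b + 1"
| "mcost (MScale x a) = scost x + mcost a + 1"
| "mcost (MAdj a) = mcost a + 1"
| "mcost (MInv a) = mcost a + 1"
| "mcost (MEigvecs a) = mcost a + 1"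
| "mcost (MEigvals a) = mcost a + 1"
| "scost (SReg r) = 1"
| "scost (SInt k) = 1"
| "scost SImag = 1"
| "scost (SAdd x y) = scost x + scost y + 1"
| "scost (SMul x y) = scost x + scost y + 1"
| "scost (SInv x) = scost x + 1"
| "scost (SCnj x) = scost x + 1"
| "scost (SSqrt x) = scost x + 1"
| "scost (SEntry a i j) = mcost a + 1"
| "scost (STrace a) = mcost a + 1"
| "scost (SDet a) = mcost a + 1"
| "scost (SNorm a) = mcost a + 1"

text \<open>
  \<open>exec orc P c s t s'\<close>: with oracle \<open>orc\<close> and procedure table \<open>P\<close>, command \<open>c\<close> started in
  \<open>s\<close> terminates in \<open>s'\<close> at cost \<open>t\<close>.  Tests compare real parts.  A procedure works on its
  own copy of the registers (a program mentions only finitely many, and words are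
  copied by reference); it returns the contents of register 0 of each sort to the caller.
  A call of a procedure that is not in the table does not terminate.
\<close>

inductive exec :: "('n::finite cmat \<Rightarrow> 'n cmat list) \<Rightarrow> ('n, 'n cmat) com list \<Rightarrow>
    ('n, 'n cmat) com \<Rightarrow> 'n state \<Rightarrow> nat \<Rightarrow> 'n state \<Rightarrow> bool"
  for orc P where
  Skip: "exec orc P Skip s 1 s"
| SetM: "exec orc P (SetM r a) s (1 + mcost a) (s\<lparr>mreg := (mreg s)(r := mval a s)\<rparr>)"
| SetS: "exec orc P (SetS r x) s (1 + scost x) (s\<lparr>sreg := (sreg s)(r := sval x s)\<rparr>)"
| SetW: "exec orc P (SetW r w) s (1 + length w) (s\<lparr>wreg := (wreg s)(r := w)\<rparr>)"
| Copy: "exec orc P (Copy r q) s 1 (s\<lparr>wreg := (wreg s)(r := wreg s q)\<rparr>)"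
| Append: "w = wreg s p @ wreg s q \<Longrightarrow>
    exec orc P (Append r p q) s (1 + length w) (s\<lparr>wreg := (wreg s)(r := w)\<rparr>)"
| Multiply_Out: "exec orc P (Multiply_Out r q) s (1 + length (wreg s q))
    (s\<lparr>mreg := (mreg s)(r := word_prod (wreg s q))\<rparr>)"
| Query: "exec orc P (Query r a) s (1 + mcost a) (s\<lparr>wreg := (wreg s)(r := orc (mval a s))\<rparr>)"
| Seq: "exec orc P c s t s' \<Longrightarrow> exec orc P c' s' t' s'' \<Longrightarrow> exec orc P (Seq c c') s (t + t') s''"
| If_True: "Re (sval x s) \<le> Re (sval y s) \<Longrightarrow> exec orc P c s t s' \<Longrightarrow>
    exec orc P (If_Le x y c c') s (1 + scost x + scost y + t) s'"
| If_False: "\<not> Re (sval x s) \<le> Re (sval y s) \<Longrightarrow> exec orc P c' s t s' \<Longrightarrow>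
    exec orc P (If_Le x y c c') s (1 + scost x + scost y + t) s'"
| While_True: "Re (sval x s) \<le> Re (sval y s) \<Longrightarrow> exec orc P c s t s' \<Longrightarrow>
    exec orc P (While_Le x y c) s' t' s'' \<Longrightarrow>
    exec orc P (While_Le x y c) s (1 + scost x + scost y + t + t') s''"
| While_False: "\<not> Re (sval x s) \<le> Re (sval y s) \<Longrightarrow>
    exec orc P (While_Le x y c) s (1 + scost x + scost y) s"
| Call: "p < length P \<Longrightarrow> exec orc P (P ! p) s t s' \<Longrightarrow>
    exec orc P (Call p) s (1 + t)
      (s\<lparr>mreg := (mreg s)(0 := mreg s' 0),
         sreg := (sreg s)(0 := sreg s' 0),
         wreg := (wreg s)(0 := wreg s' 0)\<rparr>)"

inductive_cases exec_elims:
  "exec orc P Skip s t s'"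
  "exec orc P (SetM r a) s t s'"
  "exec orc P (SetS r x) s t s'"
  "exec orc P (SetW r w) s t s'"
  "exec orc P (Copy r q) s t s'"
  "exec orc P (Append r p q) s t s'"
  "exec orc P (Multiply_Out r q) s t s'"
  "exec orc P (Query r a) s t s'"
  "exec orc P (Seq c c') s t s'"
  "exec orc P (If_Le x y c c') s t s'"
  "exec orc P (While_Le x y c) s t s'"
  "exec orc P (Call p) s t s'"

lemma exec_deterministic:
  "exec orc P c s t s' \<Longrightarrow> exec orc P c s u s'' \<Longrightarrow> t = u \<and> s' = s''"
proof (induction arbitrary: u s'' rule: exec.induct)
  case (Seq c s t s' c' t' s2)
  from Seq.prems obtain u1 r u2 where
    "exec orc P c s u1 r" "exec orc P c' r u2 s''" "u = u1 + u2"
    by (rule exec_elims(9)) simp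
  then show ?case using Seq.IH by metis
next
  case (If_True x s y c t s' c')
  from If_True.prems obtain v where
    "exec orc P c s v s''" "u = 1 + scost x + scost y + v"
    by (rule exec_elims(10)) (simp_all add: If_True.hyps)
  then show ?case using If_True.IH by metis
next
  case (If_False x s y c' t s' c)
  from If_False.prems obtain v where
    "exec orc P c' s v s''" "u = 1 + scost x + scost y + v"
    by (rule exec_elims(10)) (simp_all add: If_False.hyps)
  then show ?case using If_False.IH by metis
next
  case (While_True x s y c t s' t' s2)
  from While_True.prems obtain u1 r u2 where
    "exec orc P c s u1 r" "exec orc P (While_Le x y c) r u2 s''"
    "u = 1 + scost x + scost y + u1 + u2"
    by (rule exec_elims(11)) (simp_all add: While_True.hyps)
  then show ?case using While_True.IH by metis
next
  case (While_False x s y c)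
  from While_False.prems show ?case
    by (rule exec_elims(11)) (simp_all add: While_False.hyps)
next
  case (Call p s t s')
  from Call.prems obtain v r where
    "exec orc P (P ! p) s v r" "u = 1 + v"
    "s'' = s\<lparr>mreg := (mreg s)(0 := mreg r 0),
         sreg := (sreg s)(0 := sreg r 0),
         wreg := (wreg s)(0 := wreg r 0)\<rparr>"
    by (rule exec_elims(12)) simp
  then show ?case using Call.IH by metis
qed (erule exec_elims; simp)+

definition init_state :: "'n::finite cmat \<Rightarrow> real \<Rightarrow> 'n state" where
  "init_state U \<epsilon> =
     \<lparr>mreg = (\<lambda>_. 0)(0 := U), sreg = (\<lambda>_. 0)(0 := of_real \<epsilon>), wreg = (\<lambda>_. [])\<rparr>"

definition gate_program :: "'n::finite cmat set \<Rightarrow> ('n, 'n cmat) com list \<Rightarrow> bool" where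
  "gate_program G P \<longleftrightarrow> (\<forall>c\<in>set P. gates c \<subseteq> G)"

text \<open>Procedure 0 is the entry point; the output is the word it returns.\<close>

definition outputs ::
  "('n::finite cmat \<Rightarrow> 'n cmat list) \<Rightarrow> ('n, 'n cmat) com list \<Rightarrow> 'n cmat \<Rightarrow> real \<Rightarrow>
     nat \<Rightarrow> 'n cmat list \<Rightarrow> bool" where
  "outputs orc P U \<epsilon> t w \<longleftrightarrow> (\<exists>s. exec orc P (Call 0) (init_state U \<epsilon>) t s \<and> wreg s 0 = w)"

text \<open>
  \<open>P\<close> compiles every target to every accuracy, with running time and output length
  at most \<open>C log\<^sup>c(1/\<epsilon>)\<close> for all sufficiently small \<open>\<epsilon>\<close>, uniformly in the target and in the
  admissible answers of the net oracle.
\<close>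

definition efficient_compiler ::
  "real \<Rightarrow> 'n::finite cmat set \<Rightarrow> 'n cmat list set \<Rightarrow> ('n, 'n cmat) com list \<Rightarrow> bool" where
  "efficient_compiler \<delta> G N P \<longleftrightarrow>
     (\<exists>C c \<epsilon>\<^sub>1 :: real. 0 < \<epsilon>\<^sub>1 \<and> \<epsilon>\<^sub>1 < 1 \<and>
       (\<forall>orc. net_oracle \<delta> N orc \<longrightarrow>
         (\<forall>U\<in>SU. \<forall>\<epsilon>>0. \<exists>t w. outputs orc P U \<epsilon> t w \<and> set w \<subseteq> G \<and>
            op_norm (word_prod w - U) \<le> \<epsilon> \<and>
            (\<epsilon> < \<epsilon>\<^sub>1 \<longrightarrow>
               real (length w) \<le> C * ln (1 / \<epsilon>) powr c \<and>
               real t \<le> C * ln (1 / \<epsilon>) powr c))))"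

end

theory Submission
  imports Defs
begin

text \<open>
  Solovay--Kitaev refinement: if \<open>u\<close> is within \<open>\<tau>\<^sup>2\<close> of \<open>U\<close>, then \<open>U u\<^sup>* - 1\<close> is, up to
  \<open>O(\<tau>\<^sup>3)\<close>, a sum of commutators \<open>[K, L]\<close> of elements of size \<open>O(\<tau>)\<close>, and \<open>1 + [K, L]\<close> is, up to
  \<open>O(\<tau>\<^sup>3)\<close>, the group commutator of unitaries near \<open>1 + K\<close> and \<open>1 + L\<close>, each of which need only be
  known up to \<open>O(\<tau>\<^sup>2)\<close>.  The inverses in the group commutator, however, are needed up to \<open>O(\<tau>\<^sup>3)\<close>,
  and the gate set has none.  They come from a self-correcting word.  Take a finite irreducible
  subgroup of \<open>SU(d)\<close> (here the one with Gaussian integer entries) and a closed walk in its complete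
  Cayley graph that uses every edge once.  Replacing each label by a word that approximates it
  up to \<open>\<eta>\<close> changes the product 1, to first order, by a sum of group averages of the errors;
  these are scalars, hence \<open>O(\<eta>\<^sup>2)\<close> by unimodularity.  If the label 1 is replaced by \<open>v v'\<close>, where
  \<open>v\<close> and \<open>v'\<close> approximate \<open>V\<close> and \<open>V\<^sup>*\<close>, and the walk starts with it, then what follows \<open>v\<close> is an
  inverse of \<open>v\<close> up to \<open>O(\<eta>\<^sup>2)\<close>.

  All implied constants depend only on \<open>d\<close>, and so does the radius below which the refinement wins.
\<close>

section \<open>Complex square matrices as a normed algebra\<close>

text \<open>The net radius is fixed before the gate set, so the constant of the refinement step must
  not depend on \<open>G\<close>; hence errors are estimated uniformly over arbitrary approximation
  procedures, and words enter only at the end. The asymmetry between factors and inverses in the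
  group commutator has a simple reason: \<open>[K, L]\<close> is bilinear in small quantities, so
  second-order errors in them are harmless, while a mismatch between a factor and its inverse enters
  linearly. Averaging works only if all occurrences of a label carry the same error, so recursive
  calls must answer as a function of target and precision. Gaussian integers serve since integers
  and \<open>\<i>\<close> are the only literals of the programs. In the same spirit the residual is
  split by matrix entries into commutators whose parameters need only square roots and inverses,
  with no logarithm.\<close>

typedef ('n::finite) mtx = "UNIV :: 'n cmat set"
  morphisms mat_of Mtx ..

setup_lifting type_definition_mtx

lemma op_norm_ge: "norm (A *v x) \<le> op_norm A * norm x"
  for A :: "'n::finite cmat"
  unfolding op_norm_def by (rule onorm) simp

lemma op_norm_bound: "0 \<le> b \<Longrightarrow> (\<And>x. norm (A *v x) \<le> b * norm x) \<Longrightarrow> op_norm A \<le> b"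
  for A :: "'n::finite cmat"
  unfolding op_norm_def by (rule onorm_bound) auto

lemma op_norm_add: "op_norm (A + B) \<le> op_norm A + op_norm B" for A B :: "'n::finite cmat"
  unfolding op_norm_def matrix_vector_mult_add_rdistrib by (rule onorm_triangle) auto

lemma op_norm_mult: "op_norm (A ** B) \<le> op_norm A * op_norm B" for A B :: "'n::finite cmat"
  using onorm_compose[of "(*v) A" "(*v) B"]
  by (simp add: op_norm_def o_def matrix_vector_mul_assoc)

text \<open>With \<open>op_norm_le_entries\<close> this makes the operator norm comparable to the
  entries, so orders of magnitude can later be checked entry by entry.\<close>

lemma norm_entry_le_op_norm: "norm (A $ i $ j) \<le> op_norm A" for A :: "'n::finite cmat"
proof -
  have "norm (A $ i $ j) = norm ((A *v axis j 1) $ i)"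
    by (simp add: matrix_vector_mult_def axis_def if_distrib cong: if_cong)
  also have "\<dots> \<le> norm (A *v axis j 1)" by (rule Finite_Cartesian_Product.norm_nth_le)
  also have "\<dots> \<le> op_norm A" using op_norm_ge[of A "axis j 1"] by simp
  finally show ?thesis .
qed

lemma op_norm_le_entries: "op_norm A \<le> (\<Sum>i\<in>UNIV. \<Sum>j\<in>UNIV. norm (A $ i $ j))"
  for A :: "'n::finite cmat"
proof (rule op_norm_bound)
  show "0 \<le> (\<Sum>i\<in>UNIV. \<Sum>j\<in>UNIV. norm (A $ i $ j))" by (intro sum_nonneg) auto
  fix x :: "complex^'n"
  have "norm (A *v x) \<le> (\<Sum>i\<in>UNIV. norm ((A *v x) $ i))"
    by (simp add: norm_vec_def L2_set_le_sum)
  also have "\<dots> \<le> (\<Sum>i\<in>UNIV. \<Sum>j\<in>UNIV. norm (A $ i $ j) * norm x)"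
  proof (rule sum_mono)
    fix i
    have "norm ((A *v x) $ i) \<le> (\<Sum>j\<in>UNIV. norm (A $ i $ j * x $ j))"
      by (simp add: matrix_vector_mult_def norm_sum)
    also have "\<dots> \<le> (\<Sum>j\<in>UNIV. norm (A $ i $ j) * norm x)"
      by (intro sum_mono) (simp add: norm_mult mult_left_mono Finite_Cartesian_Product.norm_nth_le)
    finally show "norm ((A *v x) $ i) \<le> (\<Sum>j\<in>UNIV. norm (A $ i $ j) * norm x)" .
  qed
  finally show "norm (A *v x) \<le> (\<Sum>i\<in>UNIV. \<Sum>j\<in>UNIV. norm (A $ i $ j)) * norm x"
    by (simp add: sum_distrib_right)
qed

lemma op_norm_eq_0: "op_norm A = 0 \<longleftrightarrow> A = 0" for A :: "'n::finite cmat"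
proof
  assume "op_norm A = 0"
  then have "A $ i $ j = 0" for i j using norm_entry_le_op_norm[of A i j] by simp
  then show "A = 0" by (simp add: vec_eq_iff)
qed (simp add: op_norm_def onorm_zero)

lemma op_norm_scaleR: "op_norm (r *\<^sub>R A) = \<bar>r\<bar> * op_norm A" for A :: "'n::finite cmat"
  proof -
  have "(r *\<^sub>R A) *v x = r *\<^sub>R (A *v x)" for x
    by (simp add: vec_eq_iff matrix_vector_mult_def scaleR_sum_right)
  then show ?thesis by (simp add: op_norm_def onorm_scaleR)
qed

lemma op_norm_one: "op_norm (mat 1 :: 'n::finite cmat) = 1"
  unfolding op_norm_def matrix_vector_mul_lid
proof (rule antisym[OF onorm_id_le])
  fix i :: 'n
  show "1 \<le> onorm (\<lambda>x::complex^'n. x)"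
    using le_onorm[of "\<lambda>x::complex^'n. x" "axis i 1"] by simp
qed

text \<open>The type \<open>'n cmat\<close> already carries the Euclidean norm as its
  \<open>norm\<close>; on the copy, \<open>norm\<close> can be the operator norm and
  \<open>*\<close> the matrix product.\<close>

instantiation mtx :: (finite) real_normed_algebra_1
begin

lift_definition zero_mtx :: "'a mtx" is 0 .
lift_definition one_mtx :: "'a mtx" is "mat 1" .
lift_definition plus_mtx :: "'a mtx \<Rightarrow> 'a mtx \<Rightarrow> 'a mtx" is "(+)" .
lift_definition minus_mtx :: "'a mtx \<Rightarrow> 'a mtx \<Rightarrow> 'a mtx" is "(-)" .
lift_definition uminus_mtx :: "'a mtx \<Rightarrow> 'a mtx" is uminus .
lift_definition times_mtx :: "'a mtx \<Rightarrow> 'a mtx \<Rightarrow> 'a mtx" is "(**)" .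
lift_definition scaleR_mtx :: "real \<Rightarrow> 'a mtx \<Rightarrow> 'a mtx" is scaleR .
lift_definition norm_mtx :: "'a mtx \<Rightarrow> real" is op_norm .
definition dist_mtx :: "'a mtx \<Rightarrow> 'a mtx \<Rightarrow> real" where "dist_mtx A B = norm (A - B)"
definition sgn_mtx :: "'a mtx \<Rightarrow> 'a mtx" where "sgn_mtx A = inverse (norm A) *\<^sub>R A"
definition uniformity_mtx :: "('a mtx \<times> 'a mtx) filter" where
  "uniformity_mtx = (INF e\<in>{0<..}. principal {(x, y). dist x y < e})"
definition open_mtx :: "'a mtx set \<Rightarrow> bool" where
  "open_mtx U \<longleftrightarrow> (\<forall>x\<in>U. \<forall>\<^sub>F (x', y) in uniformity. x' = x \<longrightarrow> y \<in> U)"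

instance
proof
  fix A B C :: "'a mtx" and r s :: real
  show "A + B + C = A + (B + C)" "A + B = B + A" "0 + A = A" "- A + A = 0" "A - B = A + - B"
    by (transfer; simp)+
  show "A * B * C = A * (B * C)" by transfer (simp add: matrix_mul_assoc)
  show "(A + B) * C = A * C + B * C" 
    by transfer (simp add: vec_eq_iff matrix_matrix_mult_def distrib_right sum.distrib)
  show "A * (B + C) = A * B + A * C" by transfer (simp add: matrix_add_ldistrib)
  show "1 * A = A" "A * 1 = A" by (transfer; simp)+
  show "(0::'a mtx) \<noteq> 1" by transfer (auto simp: vec_eq_iff mat_def)
  show "r *\<^sub>R (A + B) = r *\<^sub>R A + r *\<^sub>R B" "(r + s) *\<^sub>R A = r *\<^sub>R A + s *\<^sub>R A"
    "r *\<^sub>R s *\<^sub>R A = (r * s) *\<^sub>R A" "1 *\<^sub>R A = A"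
    by (transfer; simp add: scaleR_add_right scaleR_add_left)+
  show "r *\<^sub>R A * B = r *\<^sub>R (A * B)" "A * r *\<^sub>R B = r *\<^sub>R (A * B)"
    by (transfer; simp add: vec_eq_iff matrix_matrix_mult_def scaleR_sum_right)+
  show "dist A B = norm (A - B)" by (rule dist_mtx_def)
  show "sgn A = inverse (norm A) *\<^sub>R A" by (rule sgn_mtx_def)
  show "norm (r *\<^sub>R A) = \<bar>r\<bar> * norm A" by transfer (rule op_norm_scaleR)
  show "norm (A + B) \<le> norm A + norm B" by transfer (rule op_norm_add)
  show "norm (A * B) \<le> norm A * norm B" by transfer (rule op_norm_mult)
  show "norm (1 :: 'a mtx) = 1" by transfer (rule op_norm_one)
  show "norm A = 0 \<longleftrightarrow> A = 0" by transfer (rule op_norm_eq_0)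
qed (simp_all add: uniformity_mtx_def open_mtx_def)

end

section \<open>Entries, adjoint and trace\<close>

lift_definition ent :: "'n::finite mtx \<Rightarrow> 'n \<Rightarrow> 'n \<Rightarrow> complex" is "\<lambda>A i j. A $ i $ j" .
lift_definition adj :: "'n::finite mtx \<Rightarrow> 'n mtx" is conj_transpose .
lift_definition cscale :: "complex \<Rightarrow> 'n::finite mtx \<Rightarrow> 'n mtx" is "\<lambda>c A. \<chi> i j. c * A $ i $ j" .
lift_definition elem :: "'n::finite \<Rightarrow> 'n \<Rightarrow> 'n mtx" is
  "\<lambda>i j. \<chi> k l. if k = i \<and> l = j then 1 else 0" .
lift_definition tr :: "'n::finite mtx \<Rightarrow> complex" is trace .
definition su :: "'n::finite mtx set" where "su = {A. mat_of A \<in> SU}"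

lemma mat_of_nth: "mat_of A $ i $ j = ent A i j"
  by (simp add: ent.rep_eq)

lemma mtx_eqI: "(\<And>i j. ent A i j = ent B i j) \<Longrightarrow> A = B"
  by transfer (simp add: vec_eq_iff)

lemma ent_simps [simp]:
  "ent 0 i j = 0"
  "ent 1 i j = (if i = j then 1 else 0)"
  "ent (A + B) i j = ent A i j + ent B i j"
  "ent (A - B) i j = ent A i j - ent B i j"
  "ent (- A) i j = - ent A i j"
  "ent (r *\<^sub>R A) i j = of_real r * ent A i j"
  "ent (cscale c A) i j = c * ent A i j"
  "ent (adj A) i j = cnj (ent A j i)"
  "ent (elem k l) i j = (if i = k \<and> j = l then 1 else 0)"
  by (simp_all add: ent.rep_eq zero_mtx.rep_eq one_mtx.rep_eq plus_mtx.rep_eq minus_mtx.rep_eq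
      uminus_mtx.rep_eq scaleR_mtx.rep_eq cscale.rep_eq adj.rep_eq elem.rep_eq mat_def
      conj_transpose_def) (simp add: scaleR_conv_of_real)

lemma ent_mult: "ent (A * B) i j = (\<Sum>k\<in>UNIV. ent A i k * ent B k j)"
  by (simp add: ent.rep_eq times_mtx.rep_eq matrix_matrix_mult_def)

lemma ent_sum [simp]: "ent (sum f I) i j = (\<Sum>x\<in>I. ent (f x) i j)"
  by (induction I rule: infinite_finite_induct) auto

lemma tr_ent: "tr A = (\<Sum>i\<in>UNIV. ent A i i)"
  by (simp add: ent.rep_eq tr.rep_eq trace_def)

lemma norm_ent_le: "norm (ent A i j) \<le> norm A"
  by (simp add: ent.rep_eq norm_mtx.rep_eq norm_entry_le_op_norm)

lemma norm_le_ent: "norm A \<le> (\<Sum>i\<in>UNIV. \<Sum>j\<in>UNIV. norm (ent A i j))"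
  by (simp add: ent.rep_eq norm_mtx.rep_eq op_norm_le_entries)

lemma adj_mult: "adj (A * B) = adj B * adj A"
  by (rule mtx_eqI) (simp add: ent_mult cnj_sum mult.commute)

lemma adj_simps [simp]: "adj (A + B) = adj A + adj B" "adj (A - B) = adj A - adj B"
  "adj (adj A) = A" "adj 1 = 1" "adj 0 = 0" "adj (- A) = - adj A"
  by (auto intro!: mtx_eqI)

lemma tr_sum: "tr (sum f I) = (\<Sum>x\<in>I. tr (f x))"
  unfolding tr_ent ent_sum by (rule sum.swap)

lemma tr_mult_commute: "tr (A * B) = tr (B * A)"
proof -
  have "tr (A * B) = (\<Sum>k\<in>UNIV. \<Sum>i\<in>UNIV. ent A i k * ent B k i)"
    unfolding tr_ent ent_mult by (rule sum.swap)
  then show ?thesis by (simp add: tr_ent ent_mult mult.commute)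
qed

lemma cscale_mult [simp]: "cscale c A * B = cscale c (A * B)" "A * cscale c B = cscale c (A * B)"
proof -
  show "cscale c A * B = cscale c (A * B)"
    by (rule mtx_eqI) (simp add: ent_mult sum_distrib_left mult.assoc)
  show "A * cscale c B = cscale c (A * B)"
    by (rule mtx_eqI) (simp add: ent_mult sum_distrib_left mult.left_commute)
qed

section \<open>The special unitary group inside the algebra\<close>

lemma su_iff: "A \<in> su \<longleftrightarrow> adj A * A = 1 \<and> A * adj A = 1 \<and> det (mat_of A) = 1"
  by (simp add: su_def SU_def unitary_mat_def mat_of_inject[symmetric] times_mtx.rep_eq
      adj.rep_eq one_mtx.rep_eq)

lemma su_adj_mult [simp]: "A \<in> su \<Longrightarrow> adj A * A = 1" "A \<in> su \<Longrightarrow> A * adj A = 1"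
  by (auto simp: su_iff)

lemma su_det: "A \<in> su \<Longrightarrow> det (mat_of A) = 1"
  by (simp add: su_iff del: su_adj_mult)

lemma one_su [simp]: "1 \<in> su"
  by (simp add: su_iff one_mtx.rep_eq del: su_adj_mult)

lemma su_mult [intro]:
  assumes "A \<in> su" "B \<in> su" shows "A * B \<in> su"
proof -
  have "adj (A * B) * (A * B) = adj B * (adj A * A) * B"
    unfolding adj_mult by (simp only: mult.assoc)
  also have "\<dots> = 1" using assms by simp
  finally have 1: "adj (A * B) * (A * B) = 1" .
  have "(A * B) * adj (A * B) = A * (B * adj B) * adj A"
    unfolding adj_mult by (simp only: mult.assoc)
  also have "\<dots> = 1" using assms by simp
  finally have 2: "(A * B) * adj (A * B) = 1" .
  have "det (mat_of (A * B)) = 1"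
    using assms by (simp add: su_det times_mtx.rep_eq det_mul)
  with 1 2 show ?thesis unfolding su_iff by (intro conjI)
qed

lemma su_adj [intro]:
  assumes A: "A \<in> su" shows "adj A \<in> su"
proof -
  have "det (mat_of (adj A)) = det (mat_of (adj A)) * det (mat_of A)"
    using A by (simp add: su_det)
  also have "\<dots> = det (mat_of (adj A * A))" by (simp only: times_mtx.rep_eq det_mul)
  also have "\<dots> = 1" using A by (simp add: one_mtx.rep_eq)
  finally have "det (mat_of (adj A)) = 1" .
  moreover have "adj (adj A) * adj A = 1" "adj A * adj (adj A) = 1" using A by simp_all
  ultimately show ?thesis unfolding su_iff by (intro conjI)
qed

lemma su_prod_list: "(\<And>A. A \<in> set As \<Longrightarrow> A \<in> su) \<Longrightarrow> prod_list As \<in> su"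
  by (induction As) auto

lemma norm_vec_sq: "of_real ((norm x)\<^sup>2) = (\<Sum>i\<in>UNIV. cnj (x $ i) * x $ i)" for x :: "complex^'n::finite"
proof -
  have "(norm x)\<^sup>2 = (\<Sum>i\<in>UNIV. (norm (x $ i))\<^sup>2)"
    by (simp add: norm_vec_def L2_set_def sum_nonneg)
  then show ?thesis
    by (simp only: of_real_sum complex_norm_square mult.commute)
qed

text \<open>The columns of \<open>A\<close> are orthonormal, so expanding the squared Euclidean norm
  shows that \<open>A\<close> is an isometry.\<close>

lemma norm_le_1_of_adj_mult:
  assumes "adj A * A = 1" shows "norm A \<le> 1"
proof -
  let ?A = "ent A"
  have orth: "(\<Sum>i\<in>UNIV. cnj (?A i k) * ?A i j) = (if k = j then 1 else 0)" for k j
    using arg_cong[OF assms, of "\<lambda>B. ent B k j"] by (simp add: ent_mult)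
  have "norm (mat_of A *v x) = norm x" for x
  proof -
    have "complex_of_real ((norm (mat_of A *v x))\<^sup>2) =
        (\<Sum>i\<in>UNIV. (\<Sum>k\<in>UNIV. cnj (?A i k * x $ k)) * (\<Sum>j\<in>UNIV. ?A i j * x $ j))"
      by (subst norm_vec_sq) (simp add: matrix_vector_mult_def mat_of_nth)
    also have "\<dots> = (\<Sum>i\<in>UNIV. \<Sum>k\<in>UNIV. \<Sum>j\<in>UNIV. cnj (x $ k) * x $ j * (cnj (?A i k) * ?A i j))"
      unfolding sum_product by (intro sum.cong refl) simp
    also have "\<dots> = (\<Sum>k\<in>UNIV. \<Sum>i\<in>UNIV. \<Sum>j\<in>UNIV. cnj (x $ k) * x $ j * (cnj (?A i k) * ?A i j))"
      by (rule sum.swap)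
    also have "\<dots> = (\<Sum>k\<in>UNIV. \<Sum>j\<in>UNIV. \<Sum>i\<in>UNIV. cnj (x $ k) * x $ j * (cnj (?A i k) * ?A i j))"
      by (rule sum.cong[OF refl], rule sum.swap)
    also have "\<dots> = (\<Sum>k\<in>UNIV. \<Sum>j\<in>UNIV. cnj (x $ k) * x $ j * (if k = j then 1 else 0))"
      by (simp only: sum_distrib_left[symmetric] orth)
    also have "\<dots> = complex_of_real ((norm x)\<^sup>2)"
      by (subst norm_vec_sq) (simp add: if_distrib cong: if_cong)
    finally show ?thesis
      by (simp only: of_real_eq_iff power2_eq_iff_nonneg norm_ge_zero)
  qed
  then show ?thesis
    unfolding norm_mtx.rep_eq by (intro op_norm_bound) auto
qed

lemma norm_su_le: "A \<in> su \<Longrightarrow> norm A \<le> 1"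
  by (rule norm_le_1_of_adj_mult) simp

section \<open>Uniform orders of magnitude\<close>

locale scaling =
  fixes X :: "'x set" and t :: "'x \<Rightarrow> real"
  assumes t_nonneg: "x \<in> X \<Longrightarrow> 0 \<le> t x" and t_le_1: "x \<in> X \<Longrightarrow> t x \<le> 1"
begin

text \<open>
  \<open>f = O(t\<^sup>k)\<close> uniformly on \<open>X\<close>.  In the application \<open>X\<close> ranges over all precisions, targets and
  approximation procedures at once, so that the constant depends on none of them.
\<close>

definition small :: "nat \<Rightarrow> ('x \<Rightarrow> 'a::real_normed_vector) \<Rightarrow> bool" where
  "small k f \<longleftrightarrow> (\<exists>C. \<forall>x\<in>X. norm (f x) \<le> C * t x ^ k)"

lemma smallI: "(\<And>x. x \<in> X \<Longrightarrow> norm (f x) \<le> C * t x ^ k) \<Longrightarrow> small k f"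
  unfolding small_def by blast

lemma smallE:
  assumes "small k f"
  obtains C where "0 \<le> C" "\<And>x. x \<in> X \<Longrightarrow> norm (f x) \<le> C * t x ^ k"
proof -
  from assms obtain C where C: "\<And>x. x \<in> X \<Longrightarrow> norm (f x) \<le> C * t x ^ k"
    unfolding small_def by blast
  have "norm (f x) \<le> max 0 C * t x ^ k" if "x \<in> X" for x
    using C[OF that] mult_right_mono[of C "max 0 C" "t x ^ k"] t_nonneg[OF that] by simp
  then show ?thesis using that[of "max 0 C"] by simp
qed

lemma small_zero [simp, intro]: "small k (\<lambda>x. 0)"
  by (rule smallI[of _ 0]) simp

lemma small_cong: "small k f \<Longrightarrow> (\<And>x. x \<in> X \<Longrightarrow> f x = g x) \<Longrightarrow> small k g"
  unfolding small_def by auto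

lemma small_le:
  assumes "small k g" "\<And>x. x \<in> X \<Longrightarrow> norm (f x) \<le> norm (g x)" shows "small k f"
  using assms unfolding small_def by (meson order_trans)

text \<open>Lower powers of \<open>t\<close> dominate because \<open>t\<close> is at most 1; this
  lets terms of different orders be added.\<close>

lemma small_weaken:
  assumes "small k f" "l \<le> k" shows "small l f"
proof -
  from assms(1) obtain C where C: "0 \<le> C" "\<And>x. x \<in> X \<Longrightarrow> norm (f x) \<le> C * t x ^ k"
    by (rule smallE) blast
  show ?thesis
  proof (rule smallI)
    fix x assume x: "x \<in> X"
    have "C * t x ^ k \<le> C * t x ^ l"
      by (intro mult_left_mono C(1) power_decreasing assms(2) t_nonneg t_le_1 x)
    with C(2)[OF x] show "norm (f x) \<le> C * t x ^ l" by linarith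
  qed
qed

lemma small_add:
  assumes "small k f" "small k g" shows "small k (\<lambda>x. f x + g x)"
proof -
  from assms obtain C D where C: "\<And>x. x \<in> X \<Longrightarrow> norm (f x) \<le> C * t x ^ k"
    and D: "\<And>x. x \<in> X \<Longrightarrow> norm (g x) \<le> D * t x ^ k"
    unfolding small_def by blast
  show ?thesis
  proof (rule smallI)
    fix x assume x: "x \<in> X"
    show "norm (f x + g x) \<le> (C + D) * t x ^ k"
      using norm_triangle_ineq[of "f x" "g x"] C[OF x] D[OF x] unfolding distrib_right by linarith
  qed
qed

lemma small_minus: "small k f \<Longrightarrow> small k (\<lambda>x. - f x)"
  unfolding small_def by simp

lemma small_diff: "small k f \<Longrightarrow> small k g \<Longrightarrow> small k (\<lambda>x. f x - g x)"
  using small_add[of k f "\<lambda>x. - g x"] small_minus[of k g] by simp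

lemma small_mult:
  fixes f g :: "'x \<Rightarrow> 'a::real_normed_algebra"
  assumes "small k f" "small l g" shows "small (k + l) (\<lambda>x. f x * g x)"
proof -
  from assms(1) obtain C where C: "0 \<le> C" "\<And>x. x \<in> X \<Longrightarrow> norm (f x) \<le> C * t x ^ k"
    by (rule smallE) blast
  from assms(2) obtain D where D: "\<And>x. x \<in> X \<Longrightarrow> norm (g x) \<le> D * t x ^ l"
    unfolding small_def by blast
  show ?thesis
  proof (rule smallI)
    fix x assume x: "x \<in> X"
    have "norm (f x * g x) \<le> norm (f x) * norm (g x)" by (rule norm_mult_ineq)
    also have "\<dots> \<le> (C * t x ^ k) * (D * t x ^ l)"
      using C D t_nonneg x by (intro mult_mono) auto
    finally show "norm (f x * g x) \<le> (C * D) * t x ^ (k + l)" by (simp add: power_add mult_ac)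
  qed
qed

lemma small_bounded: "(\<And>x. x \<in> X \<Longrightarrow> norm (f x) \<le> C) \<Longrightarrow> small 0 f"
  by (rule smallI[of _ C]) simp

lemma small_const: "small 0 (\<lambda>x. c)"
  by (rule small_bounded[of _ "norm c"]) simp

lemma small_bounded_mult:
  fixes f g :: "'x \<Rightarrow> 'a::real_normed_algebra"
  shows "small 0 g \<Longrightarrow> small k f \<Longrightarrow> small k (\<lambda>x. g x * f x)"
    and "small 0 g \<Longrightarrow> small k f \<Longrightarrow> small k (\<lambda>x. f x * g x)"
  using small_mult[of 0 g k f] small_mult[of k f 0 g] by simp_all

lemma small_sum: "(\<And>i. i \<in> I \<Longrightarrow> small k (f i)) \<Longrightarrow> small k (\<lambda>x. \<Sum>i\<in>I. f i x)"
  by (induction I rule: infinite_finite_induct) (auto intro: small_add)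


lemma small_ent: "small k f \<Longrightarrow> small k (\<lambda>x. ent (f x) i j)"
  unfolding small_def by (meson norm_ent_le order_trans)

lemma small_entI:
  assumes "\<And>i j. small k (\<lambda>x. ent (f x) i j)" shows "small k f"
proof -
  have "small k (\<lambda>x. norm (ent (f x) i j))" for i j
    using assms[of i j] by (simp add: small_def)
  then have "small k (\<lambda>x. \<Sum>i\<in>UNIV. \<Sum>j\<in>UNIV. norm (ent (f x) i j))"
    by (intro small_sum)
  then show ?thesis
    by (rule small_le) (use norm_le_ent in \<open>fastforce intro: order_trans\<close>)
qed

lemma small_adj: "small k f \<Longrightarrow> small k (\<lambda>x. adj (f x))"
  by (rule small_entI) (auto simp: small_def dest!: small_ent[unfolded small_def])

lemma small_cscale: 
  assumes "small k c" "small l f" shows "small (k + l) (\<lambda>x. cscale (c x) (f x))"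
  by (rule small_entI) (use small_mult[OF assms(1) small_ent[OF assms(2)]] in simp)

section \<open>First-order expansion of products and determinants\<close>

lemma small_prod_first_order:
  fixes m :: "'i \<Rightarrow> 'x \<Rightarrow> complex"
  assumes "finite I" "\<And>i. i \<in> I \<Longrightarrow> small k (m i)"
  shows "small (2 * k) (\<lambda>x. (\<Prod>i\<in>I. 1 + m i x) - 1 - (\<Sum>i\<in>I. m i x))"
  using assms
proof (induction I rule: finite_induct)
  case (insert i I)
  let ?P = "\<lambda>x. (\<Prod>i\<in>I. 1 + m i x) - 1 - (\<Sum>i\<in>I. m i x)"
  have P: "small (2 * k) ?P" using insert by simp
  have "small (k + k) (\<lambda>x. m i x * ?P x + m i x * (\<Sum>i\<in>I. m i x))"
    using insert.prems P by (intro small_add small_mult small_sum) (auto intro: small_weaken[of "2 * k"])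
  then have "small (2 * k) (\<lambda>x. ?P x + (m i x * ?P x + m i x * (\<Sum>i\<in>I. m i x)))"
    unfolding mult_2 by (rule small_add[OF P[unfolded mult_2]])
  then show ?case
    by (rule small_cong) (use insert.hyps in \<open>simp add: algebra_simps\<close>)
qed auto

text \<open>In the Leibniz expansion a permutation other than the identity moves some
  \<open>i\<close> and then also \<open>p i\<close>, so its term has two off-diagonal factors, both
  entries of \<open>M\<close>. The identity contributes the product of the diagonal entries.\<close>

lemma small_det_first_order:
  fixes M :: "'x \<Rightarrow> 'n::finite mtx"
  assumes M: "small k M"
  shows "small (2 * k) (\<lambda>x. det (mat_of (1 + M x)) - 1 - tr (M x))"
proof -
  let ?T = "\<lambda>p x. of_int (sign p) * (\<Prod>i\<in>UNIV. ent (1 + M x) i (p i))"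
  let ?S = "{p. p permutes (UNIV :: 'n set)}"
  have bdd: "small 0 (\<lambda>x. ent (1 + M x) i j)" for i j
    using small_add[OF small_const[of "ent 1 i j"] small_weaken[OF small_ent[OF M, of i j], of 0]] by simp
  have prod0: "small 0 (\<lambda>x. \<Prod>i\<in>I. ent (1 + M x) i (p i))" for I p
  proof (induction I rule: infinite_finite_induct)
    case (insert i I)
    then show ?case using small_mult[OF bdd[of i "p i"] insert.IH] by (simp del: ent_simps)
  qed (auto intro: small_const)
  have other: "small (2 * k) (?T p)" if p: "p \<in> ?S" "p \<noteq> id" for p
  proof -
    from p obtain i where i: "p i \<noteq> i" by (auto simp: fun_eq_iff)
    let ?j = "p i"
    have j: "p ?j \<noteq> ?j" using i p by (metis UNIV_I mem_Collect_eq permutes_inj injD)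
    have split: "(\<Prod>i\<in>UNIV. f i) = f i * (f ?j * (\<Prod>l\<in>UNIV - {i} - {?j}. f l))" for f :: "'n \<Rightarrow> complex"
      using i prod.remove[of UNIV i f] prod.remove[of "UNIV - {i}" ?j f] by auto
    have "small (k + (k + 0)) (\<lambda>x. ent (M x) i (p i) * (ent (M x) ?j (p ?j) *
        (\<Prod>l\<in>UNIV - {i} - {?j}. ent (1 + M x) l (p l))))"
      by (intro small_mult small_ent M prod0)
    then have "small (2 * k) (\<lambda>x. \<Prod>i\<in>UNIV. ent (1 + M x) i (p i))"
      unfolding mult_2 by (rule small_cong[OF small_weaken]) (use i j in \<open>auto simp: split\<close>)
    from small_bounded_mult(1)[OF small_const this] show ?thesis .
  qed
  have "small (2 * k) (\<lambda>x. (\<Prod>i\<in>UNIV. 1 + ent (M x) i i) - 1 - (\<Sum>i\<in>UNIV. ent (M x) i i))"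
    by (intro small_prod_first_order small_ent M) auto
  then have "small (2 * k) (\<lambda>x. ((\<Prod>i\<in>UNIV. 1 + ent (M x) i i) - 1 - tr (M x)) + (\<Sum>p\<in>?S - {id}. ?T p x))"
    unfolding tr_ent by (intro small_add small_sum other) auto
  then show ?thesis
  proof (rule small_cong)
    fix x
    have "det (mat_of (1 + M x)) = (\<Sum>p\<in>?S. ?T p x)"
      by (simp only: det_def mat_of_nth)
    also have "\<dots> = ?T id x + (\<Sum>p\<in>?S - {id}. ?T p x)"
      by (rule sum.remove) (auto simp: permutes_id finite_permutations)
    finally show "((\<Prod>i\<in>UNIV. 1 + ent (M x) i i) - 1 - tr (M x)) + (\<Sum>p\<in>?S - {id}. ?T p x) =
        det (mat_of (1 + M x)) - 1 - tr (M x)"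
      by (simp add: sign_id)
  qed
qed

text \<open>With determinant 1 the expansion leaves only the trace, which must therefore be of the
  order of the remainder.\<close>

lemma small_tr_su:
  assumes "small k M" "\<And>x. x \<in> X \<Longrightarrow> 1 + M x \<in> su"
  shows "small (2 * k) (\<lambda>x. tr (M x))"
  by (rule small_cong[OF small_minus[OF small_det_first_order[OF assms(1)]]])
    (simp add: su_det[OF assms(2)])

end

section \<open>The Gaussian integer points of the special unitary group\<close>

text \<open>Rows outside \<open>j, k\<close> are unit rows, so a permutation contributes only if it
  fixes every other index: the identity and one transposition remain.\<close>

lemma det_two_level:
  fixes A :: "complex^'n::finite^'n"
  assumes jk: "j \<noteq> k" and A: "\<And>r s. r \<noteq> j \<Longrightarrow> r \<noteq> k \<Longrightarrow> A $ r $ s = (if r = s then 1 else 0)"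
  shows "det A = A $ j $ j * A $ k $ k - A $ j $ k * A $ k $ j"
proof -
  let ?T = "\<lambda>p. of_int (sign p) * (\<Prod>i\<in>UNIV. A $ i $ p i)"
  let ?S = "{p. p permutes (UNIV :: 'n set)}" and ?\<tau> = "Transposition.transpose j k"
  have "det A = sum ?T ?S" by (simp add: det_def)
  also have "\<dots> = sum ?T {id, ?\<tau>}"
  proof (rule sum.mono_neutral_right)
    show "finite ?S" by (simp add: finite_permutations)
    show "{id, ?\<tau>} \<subseteq> ?S" using permutes_id permutes_swap_id[of j UNIV k] by auto
    show "\<forall>p\<in>?S - {id, ?\<tau>}. ?T p = 0"
    proof
      fix p assume p: "p \<in> ?S - {id, ?\<tau>}"
      then have "\<not> p permutes {j, k}" by (auto simp: permutes_doubleton_iff)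
      then obtain r where r: "r \<noteq> j" "r \<noteq> k" "p r \<noteq> r"
        using p permutes_superset[of p UNIV "{j, k}"] by auto
      then have "A $ r $ p r = 0" using A by auto
      then have "(\<Prod>i\<in>UNIV. A $ i $ p i) = 0" by (meson UNIV_I finite prod_zero)
      then show "?T p = 0" by simp
    qed
  qed
  also have "\<dots> = ?T id + ?T ?\<tau>"
  proof -
    have "id \<noteq> ?\<tau>" using jk by (metis id_apply transpose_apply_first)
    then show ?thesis by simp
  qed
  also have "\<dots> = A $ j $ j * A $ k $ k - A $ j $ k * A $ k $ j"
  proof -
    have prod: "(\<Prod>i\<in>UNIV. f i) = f j * f k" if "\<And>r. r \<noteq> j \<Longrightarrow> r \<noteq> k \<Longrightarrow> f r = 1" for f :: "'n \<Rightarrow> complex"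
    proof -
      have "(\<Prod>i\<in>UNIV. f i) = (\<Prod>i\<in>{j, k}. f i)"
        by (rule prod.mono_neutral_right) (use that in auto)
      then show ?thesis using jk by simp
    qed
    show ?thesis
      using jk A by (subst (1 2) prod) (auto simp: sign_id sign_swap_id)
  qed
  finally show ?thesis .
qed

text \<open>The matrix with rows \<open>(a, b)\<close> and \<open>(- cnj b, cnj a)\<close> in the coordinates \<open>j, k\<close>.\<close>

definition two_level :: "'n::finite \<Rightarrow> 'n \<Rightarrow> complex \<Rightarrow> complex \<Rightarrow> 'n mtx" where
  "two_level j k a b =
     1 + cscale (a - 1) (elem j j) + cscale (cnj a - 1) (elem k k)
       + cscale b (elem j k) - cscale (cnj b) (elem k j)"

lemma ent_mult_two_rows:
  assumes "j \<noteq> k" "\<And>s. ent A r s = (if s = j then a else if s = k then b else 0)"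
  shows "ent (A * B) r s = a * ent B j s + b * ent B k s"
proof -
  have "ent (A * B) r s = (\<Sum>l\<in>{j, k}. ent A r l * ent B l s)"
    unfolding ent_mult by (rule sum.mono_neutral_right) (use assms(2) in auto)
  with assms show ?thesis by auto
qed

lemma ent_mult_unit_row:
  assumes "\<And>s. ent A r s = (if s = r then 1 else 0)"
  shows "ent (A * B) r s = ent B r s"
proof -
  have "ent (A * B) r s = (\<Sum>l\<in>{r}. ent A r l * ent B l s)"
    unfolding ent_mult by (rule sum.mono_neutral_right) (use assms in auto)
  with assms show ?thesis by auto
qed

lemma ent_two_level:
  assumes "j \<noteq> k"
  shows "ent (two_level j k a b) r s =
    (if r = j then if s = j then a else if s = k then b else 0
     else if r = k then if s = j then - cnj b else if s = k then cnj a else 0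
     else if r = s then 1 else 0)"
  using assms by (auto simp: two_level_def)

lemma adj_two_level: "j \<noteq> k \<Longrightarrow> adj (two_level j k a b) = two_level j k (cnj a) (- b)"
  by (rule mtx_eqI) (simp add: ent_two_level)

lemma two_level_mult_adj:
  assumes jk: "j \<noteq> k" and ab: "a * cnj a + b * cnj b = 1"
  shows "two_level j k a b * two_level j k (cnj a) (- b) = 1"
proof (rule mtx_eqI)
  fix r s
  let ?A = "two_level j k a b" and ?B = "two_level j k (cnj a) (- b)"
  consider "r = j" | "r = k" | "r \<noteq> j" "r \<noteq> k" by blast
  then show "ent (?A * ?B) r s = ent 1 r s"
  proof cases
    case 1
    have "ent (?A * ?B) r s = a * ent ?B j s + b * ent ?B k s"
      by (rule ent_mult_two_rows[OF jk]) (use 1 jk in \<open>simp add: ent_two_level\<close>)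
    then show ?thesis using 1 jk ab by (auto simp: ent_two_level mult.commute)
  next
    case 2
    have "ent (?A * ?B) r s = (- cnj b) * ent ?B j s + cnj a * ent ?B k s"
      by (rule ent_mult_two_rows[OF jk]) (use 2 jk in \<open>auto simp: ent_two_level\<close>)
    also have "\<dots> = ent 1 r s"
      using 2 jk ab by (simp add: ent_two_level mult.commute add.commute)
    finally show ?thesis .
  next
    case 3
    have "ent (?A * ?B) r s = ent ?B r s"
      by (rule ent_mult_unit_row) (use 3 jk in \<open>auto simp: ent_two_level\<close>)
    then show ?thesis using 3 jk by (simp add: ent_two_level)
  qed
qed

lemma two_level_su:
  assumes jk: "j \<noteq> k" and ab: "a * cnj a + b * cnj b = 1"
  shows "two_level j k a b \<in> su"
proof -
  have "det (mat_of (two_level j k a b)) = 1"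
    by (subst det_two_level[OF jk]) (use jk ab in \<open>auto simp: mat_of_nth ent_two_level\<close>)
  moreover have "two_level j k (cnj a) (- b) * two_level j k a b = 1"
    using two_level_mult_adj[OF jk, of "cnj a" "- b"] ab by (simp add: mult.commute)
  ultimately show ?thesis
    using two_level_mult_adj[OF jk ab] by (simp add: su_iff adj_two_level[OF jk] del: su_adj_mult)
qed

text \<open>Unitarity bounds the entries by 1, so integrality makes the group finite.\<close>

definition gauss_su :: "'n::finite mtx set" where
  "gauss_su = {A \<in> su. \<forall>i j. Re (ent A i j) \<in> \<int> \<and> Im (ent A i j) \<in> \<int>}"

lemma finite_gauss_su: "finite (gauss_su :: 'n::finite mtx set)"
proof -
  let ?Z = "{z. Re z \<in> {-1, 0, 1} \<and> Im z \<in> {-1, 0, 1}}"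
  have int: "x \<in> {-1, 0, 1}" if "x \<in> \<int>" "\<bar>x\<bar> \<le> 1" for x :: real
  proof -
    from that(1) obtain n where "x = of_int n" by (rule Ints_cases)
    with that(2) have "n = -1 \<or> n = 0 \<or> n = 1" by linarith
    with \<open>x = of_int n\<close> show ?thesis by auto
  qed
  have "finite ?Z"
  proof (rule finite_subset)
    show "?Z \<subseteq> (\<lambda>(a, b). Complex a b) ` ({-1, 0, 1} \<times> {-1, 0, 1})"
    proof
      fix z assume "z \<in> ?Z"
      then show "z \<in> (\<lambda>(a, b). Complex a b) ` ({-1, 0, 1} \<times> {-1, 0, 1})"
        by (intro image_eqI[of _ _ "(Re z, Im z)"]) auto
    qed
  qed auto
  then have fin: "finite (UNIV \<rightarrow>\<^sub>E UNIV \<rightarrow>\<^sub>E ?Z :: ('n \<Rightarrow> 'n \<Rightarrow> complex) set)"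
    by (intro finite_PiE) auto
  have "ent ` gauss_su \<subseteq> (UNIV \<rightarrow>\<^sub>E UNIV \<rightarrow>\<^sub>E ?Z :: ('n \<Rightarrow> 'n \<Rightarrow> complex) set)"
  proof (clarsimp simp: PiE_iff gauss_su_def extensional_def simp del: insert_iff)
    fix A :: "'n mtx" and i j assume A: "A \<in> su" "\<forall>i j. Re (ent A i j) \<in> \<int> \<and> Im (ent A i j) \<in> \<int>"
    have "norm (ent A i j) \<le> 1" using norm_ent_le[of A i j] norm_su_le[OF A(1)] by linarith
    then have "\<bar>Re (ent A i j)\<bar> \<le> 1" "\<bar>Im (ent A i j)\<bar> \<le> 1"
      using abs_Re_le_cmod[of "ent A i j"] abs_Im_le_cmod[of "ent A i j"] by linarith+
    with A(2) show "Re (ent A i j) \<in> {-1, 0, 1} \<and> Im (ent A i j) \<in> {-1, 0, 1}"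
      by (intro conjI int) auto
  qed
  then have "finite (ent ` (gauss_su :: 'n mtx set))" using fin by (rule finite_subset)
  moreover have "inj_on ent gauss_su" by (rule inj_onI) (metis mtx_eqI)
  ultimately show ?thesis by (rule finite_imageD)
qed

lemma gauss_su_in_su: "A \<in> gauss_su \<Longrightarrow> A \<in> su"
  by (simp add: gauss_su_def)

lemma gauss_su_mult: "A \<in> gauss_su \<Longrightarrow> B \<in> gauss_su \<Longrightarrow> A * B \<in> gauss_su"
  by (auto simp: gauss_su_def ent_mult intro!: Ints_sum Ints_diff Ints_add Ints_mult)

lemma gauss_su_adj: "A \<in> gauss_su \<Longrightarrow> adj A \<in> gauss_su"
  by (auto simp: gauss_su_def)

lemma gauss_su_one: "1 \<in> gauss_su"
  by (auto simp: gauss_su_def)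

text \<open>These elements carry irreducibility: commuting with the diagonal one annihilates the
  entry at \<open>j, k\<close>, and commuting with the signed transposition equates the diagonal
  entries at \<open>j\<close> and \<open>k\<close>.\<close>

lemma gauss_su_two_level:
  "j \<noteq> k \<Longrightarrow> two_level j k \<i> 0 \<in> gauss_su" "j \<noteq> k \<Longrightarrow> two_level j k 0 1 \<in> gauss_su"
  by (auto simp: gauss_su_def two_level_su ent_two_level)

lemma bij_gauss_su_mult:
  assumes h: "h \<in> gauss_su" shows "bij_betw (\<lambda>g. h * g) gauss_su gauss_su"
  by (rule bij_betw_byWitness[where f' = "\<lambda>g. adj h * g"])
    (use h in \<open>auto simp: mult.assoc[symmetric] gauss_su_in_su gauss_su_mult gauss_su_adj\<close>)

text \<open>Schur's lemma: the twirl commutes with the group, which acts irreducibly.\<close>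

lemma gauss_twirl:
  fixes E :: "'n::finite mtx"
  shows "(\<Sum>g\<in>gauss_su. g * E * adj g) =
    cscale (of_nat (card (gauss_su :: 'n mtx set)) / of_nat CARD('n) * tr E) 1"
proof -
  let ?T = "\<Sum>g\<in>gauss_su. g * E * adj g"
  have comm: "h * ?T = ?T * h" if h: "h \<in> gauss_su" for h
  proof -
    have "h * ?T * adj h = (\<Sum>g\<in>gauss_su. (h * g) * E * adj (h * g))"
      by (simp add: sum_distrib_left sum_distrib_right adj_mult mult.assoc)
    also have "\<dots> = ?T" by (rule sum.reindex_bij_betw[OF bij_gauss_su_mult[OF h]])
    finally have "h * ?T * adj h * h = ?T * h" by simp
    then show ?thesis using gauss_su_in_su[OF h] by (simp add: mult.assoc)
  qed
  have off: "ent ?T j k = 0" and diag: "ent ?T j j = ent ?T k k" if jk: "j \<noteq> k" for j k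
  proof -
    have row: "ent (two_level j k a b * ?T) j s = a * ent ?T j s + b * ent ?T k s" for a b s
      by (rule ent_mult_two_rows[OF jk]) (use jk in \<open>simp add: ent_two_level\<close>)
    have col: "ent (?T * two_level j k a b) j k = ent ?T j j * b + ent ?T j k * cnj a" for a b
    proof -
      have "ent (?T * two_level j k a b) j k = (\<Sum>l\<in>{j, k}. ent ?T j l * ent (two_level j k a b) l k)"
        unfolding ent_mult by (rule sum.mono_neutral_right) (use jk in \<open>auto simp: ent_two_level\<close>)
      then show ?thesis using jk by (simp add: ent_two_level del: ent_sum)
    qed
    show "ent ?T j k = 0"
      using row[of \<i> 0 k] col[of \<i> 0] comm[OF gauss_su_two_level(1)[OF jk]] 
      by (simp del: ent_sum)
    then show "ent ?T j j = ent ?T k k"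
      using row[of 0 1 k] col[of 0 1] comm[OF gauss_su_two_level(2)[OF jk]] by (simp del: ent_sum)
  qed
  obtain c where c: "\<And>j. ent ?T j j = c" using diag by metis
  have T: "?T = cscale c 1"
    by (rule mtx_eqI) (use off c in \<open>simp del: ent_sum\<close>)
  \<comment> \<open>Conjugation preserves the trace, so comparing traces determines the scalar
    \<open>c\<close>.\<close>
  have "of_nat CARD('n) * c = tr ?T" unfolding T by (simp add: tr_ent)
  also have "\<dots> = (\<Sum>g\<in>gauss_su. tr (E * (adj g * g)))"
    unfolding tr_sum by (intro sum.cong refl) (metis tr_mult_commute mult.assoc)
  also have "\<dots> = of_nat (card (gauss_su :: 'n mtx set)) * tr E"
    by (simp add: gauss_su_in_su)
  finally have "c = of_nat (card (gauss_su :: 'n mtx set)) / of_nat CARD('n) * tr E"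
    by (simp add: field_simps)
  with T show ?thesis by simp
qed

section \<open>Self-correcting words\<close>

primrec edges :: "'a \<Rightarrow> 'a list \<Rightarrow> ('a \<times> 'a) list" where
  "edges p [] = []"
| "edges p (q # vs) = (p, q) # edges q vs"

lemma edges_append: "edges p (us @ vs) = edges p us @ edges (last (p # us)) vs"
  by (induction us arbitrary: p) auto

lemma set_edges_subset: "set (edges p vs) \<subseteq> set (p # vs) \<times> set (p # vs)"
  by (induction vs arbitrary: p) force+

lemma edges_excursions:
  "edges a (concat (map (\<lambda>s. [s, a]) ss) @ [e]) = concat (map (\<lambda>s. [(a, s), (s, a)]) ss) @ [(a, e)]"
  by (induction ss) auto

text \<open>When a vertex \<open>a\<close> is added, the closed walk is prolonged from
  \<open>e\<close> by the edge to \<open>a\<close>, the loop at \<open>a\<close>, an excursion from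
  \<open>a\<close> to every \<open>s\<close> in \<open>S\<close> and back, and the edge back to
  \<open>e\<close>. These are exactly the missing edges, each once. The vertex \<open>e\<close> is
  kept apart because the walk must begin with its loop.\<close>

lemma closed_walk_exists:
  assumes "finite S" "e \<notin> S"
  shows "\<exists>vs. distinct (edges e (e # vs)) \<and> set (edges e (e # vs)) = insert e S \<times> insert e S \<and>
    last (e # vs) = e \<and> set vs \<subseteq> insert e S"
  using assms
proof (induction S rule: finite_induct)
  case empty
  show ?case by (rule exI[of _ "[]"]) auto
next
  case (insert a S)
  then obtain vs where vs: "distinct (edges e (e # vs))"
    "set (edges e (e # vs)) = insert e S \<times> insert e S" "last (e # vs) = e" "set vs \<subseteq> insert e S"
    by auto
  obtain ss where ss: "distinct ss" "set ss = S" using finite_distinct_list[OF insert.hyps(1)] by blast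
  let ?new = "a # a # concat (map (\<lambda>s. [s, a]) ss) @ [e]"
  have new: "edges e (e # vs @ ?new) =
      edges e (e # vs) @ (e, a) # (a, a) # concat (map (\<lambda>s. [(a, s), (s, a)]) ss) @ [(a, e)]"
    using edges_append[of e "e # vs" ?new] vs(3) by (simp add: edges_excursions split: if_splits)
  have "a \<notin> set ss \<Longrightarrow> distinct (concat (map (\<lambda>s. [(a, s), (s, a)]) ss))"
    using ss(1) by (induction ss) auto
  moreover have "a \<noteq> e" "a \<notin> S" "e \<notin> S" using insert by auto
  ultimately have "distinct (edges e (e # vs @ ?new))"
    unfolding new using vs(1,2) ss by (auto simp del: edges.simps)
  moreover have "set (edges e (e # vs @ ?new)) = insert e (insert a S) \<times> insert e (insert a S)"
    unfolding new set_append vs(2) using ss(2) by (auto simp del: edges.simps)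
  moreover have "last (e # vs @ ?new) = e" by simp
  moreover have "set (vs @ ?new) \<subseteq> insert e (insert a S)" using vs(4) ss(2) by auto
  ultimately show ?case by blast
qed

text \<open>
  The labels of a closed walk in the complete Cayley graph of the group that starts with the
  loop at the identity and traverses every edge exactly once; the label of that first loop is
  dropped, so that \<open>1 # correction\<close> has product 1.
\<close>

definition correction_walk :: "'n::finite mtx list" where
  "correction_walk = (SOME vs. distinct (edges 1 (1 # vs)) \<and>
     set (edges 1 (1 # vs)) = gauss_su \<times> gauss_su \<and> last (1 # vs) = 1 \<and> set vs \<subseteq> gauss_su)"

lemma correction_walk:
  "distinct (edges 1 (1 # correction_walk :: 'n::finite mtx list))"
  "set (edges 1 (1 # correction_walk :: 'n mtx list)) = gauss_su \<times> gauss_su"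
  "last (1 # correction_walk) = (1 :: 'n mtx)" "set (correction_walk :: 'n mtx list) \<subseteq> gauss_su"
proof -
  have ins: "insert 1 (gauss_su - {1}) = (gauss_su :: 'n mtx set)" using gauss_su_one by auto
  have "finite (gauss_su - {1 :: 'n mtx})" "1 \<notin> gauss_su - {1 :: 'n mtx}"
    by (simp_all add: finite_gauss_su)
  from closed_walk_exists[OF this, unfolded ins]
  have "\<exists>vs. distinct (edges 1 (1 # vs)) \<and>
     set (edges 1 (1 # vs)) = gauss_su \<times> gauss_su \<and> last (1 # vs) = (1 :: 'n mtx) \<and> set vs \<subseteq> gauss_su"
    .
  note * = someI_ex[OF this, folded correction_walk_def]
  show "distinct (edges 1 (1 # correction_walk :: 'n mtx list))"
    "set (edges 1 (1 # correction_walk :: 'n mtx list)) = gauss_su \<times> gauss_su"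
    "last (1 # correction_walk) = (1 :: 'n mtx)" "set (correction_walk :: 'n mtx list) \<subseteq> gauss_su"
    by (rule conjunct1[OF *], rule conjunct1[OF conjunct2[OF *]],
        rule conjunct1[OF conjunct2[OF conjunct2[OF *]]], rule conjunct2[OF conjunct2[OF conjunct2[OF *]]])
qed

text \<open>An edge is labelled by the element that carries \<open>P\<close> to \<open>Q\<close>
  under right multiplication, so the product of the labels telescopes.\<close>

definition labels :: "'n::finite mtx \<Rightarrow> 'n mtx list \<Rightarrow> 'n mtx list" where
  "labels P vs = map (\<lambda>(P, Q). adj P * Q) (edges P vs)"

lemma labels_simps [simp]: "labels P [] = []" "labels P (Q # vs) = (adj P * Q) # labels Q vs"
  by (simp_all add: labels_def)

lemma set_labels: "set (P # vs) \<subseteq> gauss_su \<Longrightarrow> set (labels P vs) \<subseteq> gauss_su"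
  by (induction vs arbitrary: P) (auto simp: gauss_su_mult gauss_su_adj)

definition correction :: "'n::finite mtx list" where
  "correction = labels 1 correction_walk"

lemma set_correction: "set correction \<subseteq> gauss_su"
  unfolding correction_def by (rule set_labels) (use correction_walk(4) gauss_su_one in auto)

context scaling
begin

lemma small_sum_list: "(\<And>i. i \<in> set is \<Longrightarrow> small k (f i)) \<Longrightarrow> small k (\<lambda>x. \<Sum>i\<leftarrow>is. f i x)"
  by (induction "is") (auto intro: small_add)

lemma small_su: "(\<And>x. x \<in> X \<Longrightarrow> f x \<in> su) \<Longrightarrow> small 0 f"
  by (rule small_bounded[of _ 1]) (simp add: norm_su_le)

text \<open>Write \<open>a x h = h * (1 + E h x)\<close>. The factor of an edge from
  \<open>P\<close> to \<open>Q\<close>, multiplied by \<open>P\<close> on the left and by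
  \<open>adj Q\<close> on the right, is \<open>1 + Q * E h x * adj Q\<close> with
  \<open>h = adj P * Q\<close>. The conjugating matrices cancel between consecutive edges, and the
  resulting product is expanded to first order.\<close>

lemma walk_first_order:
  fixes a :: "'x \<Rightarrow> 'n::finite mtx \<Rightarrow> 'n mtx"
  assumes E_def: "\<And>h x. E h x = adj h * a x h - 1"
    and a: "\<And>h. h \<in> gauss_su \<Longrightarrow> small k (E h)"
    and "set (P # vs) \<subseteq> gauss_su"
  shows "small (2 * k) (\<lambda>x. P * prod_list (map (a x) (labels P vs)) * adj (last (P # vs)) - 1 -
    (\<Sum>(P, Q)\<leftarrow>edges P vs. Q * E (adj P * Q) x * adj Q))"
  using assms(3)
proof (induction vs arbitrary: P)
  case Nil
  then show ?case by (simp add: gauss_su_in_su)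
next
  case (Cons Q vs)
  let ?S = "\<lambda>x. \<Sum>(P, Q)\<leftarrow>edges Q vs. Q * E (adj P * Q) x * adj Q"
  let ?R = "\<lambda>x. Q * prod_list (map (a x) (labels Q vs)) * adj (last (Q # vs))"
  let ?B = "\<lambda>x. Q * E (adj P * Q) x * adj Q"
  have PQ: "P \<in> su" "Q \<in> su" "adj P * Q \<in> gauss_su"
    using Cons.prems by (auto simp: gauss_su_in_su gauss_su_mult gauss_su_adj)
  have conj: "small k (\<lambda>x. Q * E (adj P * Q) x * adj Q)" if "P \<in> gauss_su" "Q \<in> gauss_su" for P Q
    using that by (intro small_bounded_mult small_const a gauss_su_mult gauss_su_adj)
  have B: "small k ?B" using Cons.prems by (intro conj) auto
  have S: "small k ?S"
    by (rule small_sum_list) (use set_edges_subset[of Q vs] Cons.prems in \<open>auto intro!: conj\<close>)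
  have r: "small (2 * k) (\<lambda>x. ?R x - 1 - ?S x)" using Cons by simp
  \<comment> \<open>The exact remainder of \<open>(1 + ?B x) * ?R x\<close> after subtracting 1,
    \<open>?S x\<close> and \<open>?B x\<close>.\<close>
  have "small (2 * k) (\<lambda>x. (?R x - 1 - ?S x) + ?B x * ?S x + ?B x * (?R x - 1 - ?S x))"
  proof (intro small_add r)
    show "small (2 * k) (\<lambda>x. ?B x * ?S x)" using small_mult[OF B S] by (simp add: mult_2)
    show "small (2 * k) (\<lambda>x. ?B x * (?R x - 1 - ?S x))"
      by (intro small_bounded_mult r small_weaken[OF B]) simp
  qed
  then show ?case
  proof (rule small_cong)
    fix x
    have "?B x = Q * adj Q * P * a x (adj P * Q) * adj Q - Q * adj Q"
      unfolding E_def by (simp only: adj_mult adj_simps right_diff_distrib left_diff_distrib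
          mult.assoc mult_1_right mult_1_left)
    then have "1 + ?B x = Q * adj Q * P * a x (adj P * Q) * adj Q"
      using PQ by simp
    then have "(1 + ?B x) * Q = (Q * adj Q) * P * a x (adj P * Q) * (adj Q * Q)"
      by (simp only: mult.assoc)
    also have "\<dots> = P * a x (adj P * Q)" using PQ by simp
    finally have "P * prod_list (map (a x) (labels P (Q # vs))) * adj (last (P # Q # vs)) = (1 + ?B x) * ?R x"
      by (simp add: mult.assoc[symmetric])
    then show "(?R x - 1 - ?S x) + ?B x * ?S x + ?B x * (?R x - 1 - ?S x) =
      P * prod_list (map (a x) (labels P (Q # vs))) * adj (last (P # Q # vs)) - 1 -
      (\<Sum>(P, Q)\<leftarrow>edges P (Q # vs). Q * E (adj P * Q) x * adj Q)"
      by (simp add: algebra_simps)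
  qed
qed

text \<open>
  Each label occurs once at every vertex, so the first-order part of its error is twirled into
  a scalar, and that scalar is of second order because determinants are 1.
\<close>

lemma self_correction:
  fixes a :: "'x \<Rightarrow> 'n::finite mtx \<Rightarrow> 'n mtx"
  assumes a: "\<And>h. h \<in> gauss_su \<Longrightarrow> small k (\<lambda>x. a x h - h)"
    and a_su: "\<And>x h. x \<in> X \<Longrightarrow> h \<in> gauss_su \<Longrightarrow> a x h \<in> su"
  shows "small (2 * k) (\<lambda>x. a x 1 * prod_list (map (a x) correction) - 1)"
proof -
  define E where "E = (\<lambda>h x. adj h * a x h - 1)"
  let ?\<Gamma> = "gauss_su :: 'n mtx set"
  have E: "small k (E h)" if h: "h \<in> gauss_su" for h
    using small_bounded_mult(1)[OF small_const[of "adj h"] a[OF h]] gauss_su_in_su[OF h]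
    by (simp add: E_def right_diff_distrib)
  have trE: "small (2 * k) (\<lambda>x. tr (E h x))" if h: "h \<in> gauss_su" for h
    using h by (intro small_tr_su[OF E[OF h]]) (auto simp: E_def a_su gauss_su_in_su intro!: su_mult su_adj)
  have "small (2 * k) (\<lambda>x. \<Sum>h\<in>?\<Gamma>. cscale (of_nat (card ?\<Gamma>) / of_nat CARD('n) * tr (E h x)) 1)"
  proof (rule small_sum)
    fix h assume "h \<in> ?\<Gamma>"
    from small_cscale[OF small_bounded_mult(1)[OF small_const trE[OF this]] small_const, of _ 1]
    show "small (2 * k) (\<lambda>x. cscale (of_nat (card ?\<Gamma>) / of_nat CARD('n) * tr (E h x)) 1)"
      unfolding add_0_right .
  qed
  then have lin: "small (2 * k) (\<lambda>x. \<Sum>(P, Q)\<leftarrow>edges 1 (1 # correction_walk). Q * E (adj P * Q) x * adj Q)"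
  proof (rule small_cong)
    fix x
    have "(\<Sum>(P, Q)\<leftarrow>edges 1 (1 # correction_walk). Q * E (adj P * Q) x * adj Q) =
        (\<Sum>(P, Q)\<in>?\<Gamma> \<times> ?\<Gamma>. Q * E (adj P * Q) x * adj Q)"
      using sum_list_distinct_conv_sum_set[OF correction_walk(1)] by (simp only: correction_walk(2))
    also have "\<dots> = (\<Sum>P\<in>?\<Gamma>. \<Sum>Q\<in>?\<Gamma>. Q * E (adj P * Q) x * adj Q)"
      by (rule sum.cartesian_product[symmetric])
    also have "\<dots> = (\<Sum>Q\<in>?\<Gamma>. \<Sum>P\<in>?\<Gamma>. Q * E (adj P * Q) x * adj Q)"
      by (rule sum.swap)
    \<comment> \<open>For fixed \<open>Q\<close> the label \<open>adj P * Q\<close> runs through the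
      whole group as \<open>P\<close> does; what remains over \<open>Q\<close> is the twirl of the
      error of one label.\<close>
    also have "\<dots> = (\<Sum>Q\<in>?\<Gamma>. \<Sum>h\<in>?\<Gamma>. Q * E h x * adj Q)"
    proof (rule sum.cong[OF refl])
      fix Q assume Q: "Q \<in> ?\<Gamma>"
      have "bij_betw (\<lambda>P. adj P * Q) ?\<Gamma> ?\<Gamma>"
        by (rule bij_betw_byWitness[where f' = "\<lambda>h. Q * adj h"])
          (use Q in \<open>auto simp: mult.assoc mult.assoc[symmetric, of Q] adj_mult gauss_su_in_su gauss_su_mult gauss_su_adj\<close>)
      from sum.reindex_bij_betw[OF this]
      show "(\<Sum>P\<in>?\<Gamma>. Q * E (adj P * Q) x * adj Q) = (\<Sum>h\<in>?\<Gamma>. Q * E h x * adj Q)" .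
    qed
    also have "\<dots> = (\<Sum>h\<in>?\<Gamma>. \<Sum>Q\<in>?\<Gamma>. Q * E h x * adj Q)"
      by (rule sum.swap)
    finally show "(\<Sum>h\<in>?\<Gamma>. cscale (of_nat (card ?\<Gamma>) / of_nat CARD('n) * tr (E h x)) 1) =
        (\<Sum>(P, Q)\<leftarrow>edges 1 (1 # correction_walk). Q * E (adj P * Q) x * adj Q)"
      by (simp only: gauss_twirl)
  qed
  have "set (1 # 1 # correction_walk) \<subseteq> ?\<Gamma>" using correction_walk(4) gauss_su_one by auto
  have w: "small (2 * k) (\<lambda>x. 1 * prod_list (map (a x) (labels 1 (1 # correction_walk))) *
      adj (last (1 # 1 # correction_walk)) - 1 -
      (\<Sum>(P, Q)\<leftarrow>edges 1 (1 # correction_walk). Q * E (adj P * Q) x * adj Q))"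
    by (rule walk_first_order[OF _ E \<open>set (1 # 1 # correction_walk) \<subseteq> ?\<Gamma>\<close>]) (simp add: E_def)
  have "last (1 # 1 # correction_walk) = (1 :: 'n mtx)" using correction_walk(3) by simp
  with w have "small (2 * k) (\<lambda>x. a x 1 * prod_list (map (a x) correction) - 1 -
      (\<Sum>(P, Q)\<leftarrow>edges 1 (1 # correction_walk). Q * E (adj P * Q) x * adj Q))"
    by (simp add: correction_def del: edges.simps last.simps)
  from small_add[OF this lin] show ?thesis by simp
qed

end

section \<open>The refinement step\<close>

text \<open>The leading \<open>adj V\<close> completes the first loop of the walk, whose
  \<open>V\<close> is the factor to be inverted and is supplied separately.\<close>

definition inverse_targets :: "'n::finite mtx \<Rightarrow> 'n mtx list" where
  "inverse_targets V = adj V # concat (map (\<lambda>h. if h = 1 then [V, adj V] else [h]) correction)"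

definition commutator_targets :: "'n::finite mtx \<Rightarrow> 'n mtx \<Rightarrow> 'n mtx list" where
  "commutator_targets V W = V # W # inverse_targets V @ inverse_targets W"

lemma set_inverse_targets: "V \<in> su \<Longrightarrow> set (inverse_targets V) \<subseteq> su"
  using set_correction gauss_su_in_su by (auto simp: inverse_targets_def)

context scaling
begin

lemma small_mult_diff:
  fixes f g f' g' :: "'x \<Rightarrow> 'a::real_normed_algebra"
  assumes "small k (\<lambda>x. f x - f' x)" "small k (\<lambda>x. g x - g' x)" "small 0 g" "small 0 f'"
  shows "small k (\<lambda>x. f x * g x - f' x * g' x)"
proof -
  have "small k (\<lambda>x. (f x - f' x) * g x + f' x * (g x - g' x))"
    using assms by (intro small_add small_bounded_mult)
  then show ?thesis by (simp add: algebra_simps)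
qed

text \<open>With \<open>p = v - 1\<close> and \<open>q = w - 1\<close> the identity \<open>v * w *
  adj v * adj w - 1 = (p * q - q * p) * (adj v * adj w)\<close> is exact. Second-order errors in
  \<open>p\<close> and \<open>q\<close> change the bracket by third order only, and the trailing
  factor is 1 up to first order.\<close>

lemma small_group_commutator:
  fixes v w v' w' V W K L :: "'x \<Rightarrow> 'n::finite mtx"
  assumes su: "\<And>x. x \<in> X \<Longrightarrow> v x \<in> su" "\<And>x. x \<in> X \<Longrightarrow> w x \<in> su"
    "\<And>x. x \<in> X \<Longrightarrow> v' x \<in> su"
    and v: "small 2 (\<lambda>x. v x - V x)" and w: "small 2 (\<lambda>x. w x - W x)"
    and V: "small 2 (\<lambda>x. V x - 1 - K x)" and W: "small 2 (\<lambda>x. W x - 1 - L x)"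
    and K: "small 1 K" and L: "small 1 L"
    and v': "small 3 (\<lambda>x. v x * v' x - 1)" and w': "small 3 (\<lambda>x. w x * w' x - 1)"
  shows "small 3 (\<lambda>x. v x * w x * v' x * w' x - 1 - (K x * L x - L x * K x))"
proof -
  define p q where "p = (\<lambda>x. v x - 1)" and "q = (\<lambda>x. w x - 1)"
  have pK: "small 2 (\<lambda>x. p x - K x)" and qL: "small 2 (\<lambda>x. q x - L x)"
    using small_add[OF v V] small_add[OF w W] by (simp_all add: p_def q_def algebra_simps)
  have p: "small 1 p" and q: "small 1 q"
    using small_add[OF small_weaken[OF pK] K] small_add[OF small_weaken[OF qL] L] by simp_all
  have bdd: "small 0 v" "small 0 w" "small 0 v'" "small 0 (\<lambda>x. adj (v x))" "small 0 (\<lambda>x. adj (w x))"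
    using su by (auto intro!: small_su)
  have av: "small 3 (\<lambda>x. adj (v x) - v' x)"
    by (rule small_cong[OF small_minus[OF small_bounded_mult(1)[OF bdd(4) v']]])
      (simp add: su right_diff_distrib mult.assoc[symmetric])
  have aw: "small 3 (\<lambda>x. adj (w x) - w' x)"
    by (rule small_cong[OF small_minus[OF small_bounded_mult(1)[OF bdd(5) w']]])
      (simp add: su right_diff_distrib mult.assoc[symmetric])
  have exact: "small 3 (\<lambda>x. v x * w x * adj (v x) * adj (w x) - v x * w x * v' x * w' x)"
    by (intro small_mult_diff small_bounded_mult bdd av aw) simp_all
  have pq: "small 3 (\<lambda>x. p x * q x - K x * L x)" and qp: "small 3 (\<lambda>x. q x * p x - L x * K x)"
  proof -
    have three: "2 + 1 = (3 :: nat)" "1 + 2 = (3 :: nat)" by simp_all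
    note s = small_mult[where k = 2 and l = 1, unfolded three] small_mult[where k = 1 and l = 2, unfolded three]
    have "small 3 (\<lambda>x. (p x - K x) * q x + K x * (q x - L x))"
      "small 3 (\<lambda>x. (q x - L x) * p x + L x * (p x - K x))"
      by (intro small_add s(1)[OF pK q] s(2)[OF K qL] s(1)[OF qL p] s(2)[OF L pK])+
    then show "small 3 (\<lambda>x. p x * q x - K x * L x)" "small 3 (\<lambda>x. q x * p x - L x * K x)"
      by (simp_all add: algebra_simps)
  qed
  have "small 1 (\<lambda>x. adj (v x) * adj (w x) - 1)"
  proof -
    have "small 1 (\<lambda>x. adj (v x) * adj (w x) - 1 * 1)"
      using small_adj[OF p] small_adj[OF q]
      by (intro small_mult_diff bdd small_const) (simp_all add: p_def q_def)
    then show ?thesis by simp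
  qed
  from small_mult[OF small_diff[OF small_mult[OF p q] small_mult[OF q p]] this]
  have "small 3 (\<lambda>x. (p x * q x - q x * p x) * (adj (v x) * adj (w x) - 1))"
    by (simp add: numeral_3_eq_3)
  from small_diff[OF small_add[OF this small_diff[OF pq qp]] exact]
  show ?thesis
  proof (rule small_cong)
    fix x assume x: "x \<in> X"
    have "p x * q x - q x * p x = v x * w x - w x * v x" by (simp add: p_def q_def algebra_simps)
    then have "(p x * q x - q x * p x) * (adj (v x) * adj (w x)) =
        v x * w x * adj (v x) * adj (w x) - w x * (v x * adj (v x)) * adj (w x)"
      by (simp only: left_diff_distrib mult.assoc)
    also have "\<dots> = v x * w x * adj (v x) * adj (w x) - 1" using su x by simp
    finally have c: "(p x * q x - q x * p x) * (adj (v x) * adj (w x)) =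
        v x * w x * adj (v x) * adj (w x) - 1" .
    show "(p x * q x - q x * p x) * (adj (v x) * adj (w x) - 1)
        + ((p x * q x - K x * L x) - (q x * p x - L x * K x))
        - (v x * w x * adj (v x) * adj (w x) - v x * w x * v' x * w' x) =
      v x * w x * v' x * w' x - 1 - (K x * L x - L x * K x)"
      unfolding right_diff_distrib c by simp
  qed
qed

text \<open>Each factor is 1 plus second order, so products of two deviations are of fourth order
  and the deviations simply add.\<close>

lemma small_prod_list_first_order:
  fixes f :: "'i \<Rightarrow> 'x \<Rightarrow> 'a::real_normed_algebra_1"
  assumes "\<And>i. i \<in> set is \<Longrightarrow> small 2 (N i)"
    and "\<And>i. i \<in> set is \<Longrightarrow> small 3 (\<lambda>x. f i x - 1 - N i x)"
  shows "small 3 (\<lambda>x. (\<Prod>i\<leftarrow>is. f i x) - 1 - (\<Sum>i\<leftarrow>is. N i x))"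
  using assms
proof (induction "is")
  case (Cons i "is")
  let ?S = "\<lambda>x. \<Sum>i\<leftarrow>is. N i x" and ?P = "\<lambda>x. \<Prod>i\<leftarrow>is. f i x"
  have N: "small 2 (N i)" and e: "small 3 (\<lambda>x. f i x - 1 - N i x)" using Cons.prems by auto
  have S: "small 2 ?S" by (rule small_sum_list) (use Cons.prems in auto)
  have r: "small 3 (\<lambda>x. ?P x - 1 - ?S x)" using Cons by simp
  have "small 0 (\<lambda>x. (?P x - 1 - ?S x) + ?S x + 1)"
    by (intro small_add small_weaken[OF r] small_weaken[OF S] small_const) simp_all
  then have P: "small 0 ?P" by simp
  have "small 3 (\<lambda>x. (?P x - 1 - ?S x) + N i x * ?S x + N i x * (?P x - 1 - ?S x) + (f i x - 1 - N i x) * ?P x)"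
    using small_weaken[OF small_mult[OF N S], of 3] small_weaken[OF small_mult[OF N r], of 3]
    by (intro small_add r small_bounded_mult(2)[OF P e]) simp_all
  then show ?case by (simp add: algebra_simps)
qed simp

end

text \<open>\<open>A x\<close> stands for the recursive call at precision \<open>t x ^ 2\<close>;
  its values lie in \<open>su\<close> because words over gates in \<open>SU\<close> do.\<close>

locale approximators = scaling X t for X :: "'x set" and t +
  fixes A :: "'x \<Rightarrow> 'n::finite mtx \<Rightarrow> 'n mtx"
  assumes A_su: "x \<in> X \<Longrightarrow> V \<in> su \<Longrightarrow> A x V \<in> su"
    and A_near: "x \<in> X \<Longrightarrow> V \<in> su \<Longrightarrow> norm (A x V - V) \<le> t x ^ 2"
begin

lemma A_small: "(\<And>x. x \<in> X \<Longrightarrow> V x \<in> su) \<Longrightarrow> small 2 (\<lambda>x. A x (V x) - V x)"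
  by (rule smallI[of _ 1]) (simp add: A_near)

lemma prod_A_su: "x \<in> X \<Longrightarrow> set Vs \<subseteq> su \<Longrightarrow> prod_list (map (A x) Vs) \<in> su"
  by (intro su_prod_list) (auto intro: A_su)

lemma small_inverse_targets:
  assumes V: "\<And>x. x \<in> X \<Longrightarrow> V x \<in> su"
  shows "small 4 (\<lambda>x. A x (V x) * prod_list (map (A x) (inverse_targets (V x))) - 1)"
proof -
  \<comment> \<open>The value at 1 approximates the identity by a product of two calls; each is off
    by second order, hence so is the product.\<close>
  define a where "a = (\<lambda>x h. if h = 1 then A x (V x) * A x (adj (V x)) else A x h)"
  have a_su: "a x h \<in> su" if "x \<in> X" "h \<in> gauss_su" for x h
    using that V by (auto simp: a_def gauss_su_in_su intro!: A_su su_mult su_adj)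
  have "small 2 (\<lambda>x. a x h - h)" if h: "h \<in> gauss_su" for h
  proof (cases "h = 1")
    case True
    have "small 2 (\<lambda>x. A x (V x) * A x (adj (V x)) - V x * adj (V x))"
      by (intro small_mult_diff A_small V su_adj small_su A_su)
    then have "small 2 (\<lambda>x. A x (V x) * A x (adj (V x)) - 1)"
      by (rule small_cong) (simp add: V)
    then show ?thesis using True by (simp add: a_def)
  next
    case False
    then show ?thesis using A_small[of "\<lambda>x. h"] gauss_su_in_su[OF h] by (simp add: a_def)
  qed
  from self_correction[OF this a_su]
  have "small 4 (\<lambda>x. a x 1 * prod_list (map (a x) correction) - 1)" by simp
  moreover have "prod_list (map (A x) (concat (map (\<lambda>h. if h = 1 then [V x, adj (V x)] else [h]) hs))) =
      prod_list (map (a x) hs)" for x hs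
    by (induction hs) (auto simp: a_def mult.assoc)
  ultimately show ?thesis by (simp add: inverse_targets_def a_def mult.assoc)
qed

lemma small_commutator_targets:
  assumes "\<And>x. x \<in> X \<Longrightarrow> V x \<in> su" "\<And>x. x \<in> X \<Longrightarrow> W x \<in> su"
    and "small 2 (\<lambda>x. V x - 1 - K x)" "small 2 (\<lambda>x. W x - 1 - L x)" "small 1 K" "small 1 L"
  shows "small 3 (\<lambda>x. prod_list (map (A x) (commutator_targets (V x) (W x))) - 1 - (K x * L x - L x * K x))"
proof -
  have "small 3 (\<lambda>x. A x (V x) * A x (W x) * prod_list (map (A x) (inverse_targets (V x)))
      * prod_list (map (A x) (inverse_targets (W x))) - 1 - (K x * L x - L x * K x))"
    by (rule small_group_commutator[where V = V and W = W])
      (use assms in \<open>auto intro!: A_su prod_A_su A_small set_inverse_targets small_weaken[OF small_inverse_targets]\<close>)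
  then show ?thesis by (simp add: commutator_targets_def mult.assoc)
qed

end

text \<open>
  For real \<open>z\<close>, \<open>rot j k z b\<close> is \<open>1 + gen j k z b\<close>, normalised to be unitary in the coordinates
  \<open>j, k\<close>.  Square roots and inverses suffice to compute it, unlike the exponential.
\<close>

definition rot :: "'n::finite \<Rightarrow> 'n \<Rightarrow> complex \<Rightarrow> complex \<Rightarrow> 'n mtx" where
  "rot j k z b = (let c = inverse (csqrt (1 + z * cnj z + b * cnj b))
     in two_level j k (c * (1 + \<i> * z)) (c * b))"

definition gen :: "'n::finite \<Rightarrow> 'n \<Rightarrow> complex \<Rightarrow> complex \<Rightarrow> 'n mtx" where
  "gen j k z b = cscale (\<i> * z) (elem j j) - cscale (\<i> * z) (elem k k)
     + cscale b (elem j k) - cscale (cnj b) (elem k j)"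

lemma csqrt_one_plus:
  "csqrt (1 + z * cnj z + b * cnj b) = of_real (sqrt (1 + (norm z)\<^sup>2 + (norm b)\<^sup>2))"
proof -
  have "1 + z * cnj z + b * cnj b = of_real (1 + (norm z)\<^sup>2 + (norm b)\<^sup>2)"
    by (simp only: of_real_add of_real_1 complex_norm_square)
  then show ?thesis by (simp only: csqrt_of_real add_nonneg_nonneg zero_le_one zero_le_power2)
qed

lemma rot_su:
  assumes jk: "j \<noteq> k" and z: "cnj z = z" shows "rot j k z b \<in> su"
proof -
  define c where "c = inverse (csqrt (1 + z * cnj z + b * cnj b))"
  let ?s = "1 + (norm z)\<^sup>2 + (norm b)\<^sup>2"
  have c: "c = of_real (inverse (sqrt ?s))" by (simp add: c_def csqrt_one_plus)
  have "(c * (1 + \<i> * z)) * cnj (c * (1 + \<i> * z)) + (c * b) * cnj (c * b) =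
      c * cnj c * (1 + z * cnj z + b * cnj b)"
    by (simp add: z algebra_simps)
  also have "\<dots> = of_real (inverse (sqrt ?s) * inverse (sqrt ?s) * ?s)"
    by (simp only: c complex_cnj_complex_of_real of_real_mult of_real_add of_real_1 complex_norm_square)
  also have "inverse (sqrt ?s) * inverse (sqrt ?s) * ?s = 1"
  proof -
    have "0 < ?s" by (simp add: add_pos_nonneg)
    then show ?thesis by (simp add: inverse_mult_distrib[symmetric] del: inverse_mult_distrib)
  qed
  finally show ?thesis
    unfolding rot_def Let_def c_def[symmetric] by (intro two_level_su[OF jk]) (simp only: of_real_1)
qed

lemma one_minus_inverse_sqrt:
  assumes "0 \<le> s" shows "\<bar>inverse (sqrt (1 + s)) - 1\<bar> \<le> s"
proof -
  have "1 \<le> sqrt (1 + s)" using assms by simp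
  then have "inverse (sqrt (1 + s)) \<le> 1" by (simp add: inverse_le_1_iff)
  moreover have "1 - s \<le> inverse (sqrt (1 + s))"
  proof -
    have "sqrt (1 + s) \<le> 1 + s" using assms by (simp add: real_le_lsqrt power2_eq_square mult_left_mono)
    then have "inverse (1 + s) \<le> inverse (sqrt (1 + s))" using assms by (intro le_imp_inverse_le) auto
    moreover have "1 - s \<le> inverse (1 + s)" using assms by (simp add: field_simps)
    ultimately show ?thesis by linarith
  qed
  ultimately show ?thesis by linarith
qed

section \<open>Commutators of generators in one pair of coordinates\<close>

lemma elem_mult: "elem i j * elem k l = (if j = k then elem i l else 0)"
proof (rule mtx_eqI)
  fix r s
  have "ent (elem i j * elem k l) r s = (\<Sum>m\<in>UNIV. if m = j then if r = i \<and> j = k \<and> s = l then 1 else 0 else 0)"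
    unfolding ent_mult by (intro sum.cong) auto
  then show "ent (elem i j * elem k l) r s = ent (if j = k then elem i l else 0) r s" by simp
qed

lemma cscale_simps [simp]: "cscale 0 A = 0" "cscale c 0 = 0" "cscale c (cscale d A) = cscale (c * d) A"
  "cscale c (A + B) = cscale c A + cscale c B" "cscale c (A - B) = cscale c A - cscale c B"
  by (auto intro!: mtx_eqI simp: algebra_simps)

lemma cscale_left: "cscale (a + b) A = cscale a A + cscale b A" "cscale (a - b) A = cscale a A - cscale b A"
  by (auto intro!: mtx_eqI simp: algebra_simps)

lemma gen_commutator_off:
  assumes "j \<noteq> k"
  shows "gen j k z 0 * gen j k 0 b - gen j k 0 b * gen j k z 0 =
    cscale (2 * \<i> * z * b) (elem j k) + cscale (2 * \<i> * z * cnj b) (elem k j)"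
  using assms
  by (simp add: gen_def algebra_simps elem_mult) (auto intro!: mtx_eqI)

lemma gen_commutator_diag:
  assumes "j \<noteq> k"
  shows "gen j k 0 a * gen j k 0 b - gen j k 0 b * gen j k 0 a =
    cscale (b * cnj a - a * cnj b) (elem j j - elem k k)"
  using assms
  by (simp add: gen_def algebra_simps elem_mult) (auto intro!: mtx_eqI simp: algebra_simps)

text \<open>The square root of \<open>norm m\<close>, written with operations of the expression
  language.\<close>

definition sqrt_abs :: "complex \<Rightarrow> complex" where
  "sqrt_abs m = csqrt (csqrt (m * cnj m))"

text \<open>The cofactor that completes \<open>sqrt_abs m\<close> to \<open>m / 2\<close>. At
  \<open>m = 0\<close> the convention \<open>inverse 0 = 0\<close> gives the right value, so the
  program needs no case distinction.\<close>

definition half_quot :: "complex \<Rightarrow> complex" where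
  "half_quot m = m * inverse (2 * sqrt_abs m)"

lemma sqrt_abs_eq: "sqrt_abs m = of_real (sqrt (norm m))"
proof -
  have "m * cnj m = of_real ((norm m)\<^sup>2)" by (simp only: complex_norm_square)
  also have "csqrt \<dots> = of_real (norm m)" by (subst csqrt_of_real) auto
  finally show ?thesis by (simp only: sqrt_abs_def csqrt_of_real norm_ge_zero)
qed

lemma sqrt_abs_half_quot: "sqrt_abs m * half_quot m = m / 2"
  by (cases "m = 0") (simp_all add: half_quot_def sqrt_abs_eq field_simps)

lemma norm_half_quot: "norm (half_quot m) \<le> norm (sqrt_abs m)"
proof (cases "m = 0")
  case False
  have "2 * norm (sqrt_abs m) * norm (half_quot m) = norm (sqrt_abs m) * norm (sqrt_abs m)"
    using arg_cong[OF sqrt_abs_half_quot[of m], of norm] by (simp add: norm_mult norm_divide sqrt_abs_eq)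
  moreover have "norm (sqrt_abs m) > 0" using False by (simp add: sqrt_abs_eq)
  ultimately have "2 * norm (half_quot m) = norm (sqrt_abs m)" by simp
  then show ?thesis using norm_ge_zero[of "half_quot m"] by linarith
qed (simp add: half_quot_def)

text \<open>
  The parameters are chosen such that the commutator of the two generators is \<open>rot_commutator\<close>,
  with both generators of the size of the square root of the matrix entry.
\<close>

definition rot_pair :: "bool \<times> 'n::finite \<times> 'n \<Rightarrow> 'n mtx \<Rightarrow> 'n mtx \<times> 'n mtx" where
  "rot_pair = (\<lambda>(off, j, k) M.
     if off then (rot j k (sqrt_abs (ent M j k)) 0, rot j k 0 (- \<i> / 2 * half_quot (ent M j k)))
     else (let m = (ent M j j - cnj (ent M j j)) * inverse (2 * \<i> * of_nat CARD('n))
       in (rot j k 0 (sqrt_abs m), rot j k 0 (\<i> * half_quot m))))"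

text \<open>Any order will do, since the product of the commutators is compared only with their sum.
  Both \<open>(j, k)\<close> and \<open>(k, j)\<close> occur, hence the halves in
  \<open>rot_commutator\<close>.\<close>

definition rot_indices :: "(bool \<times> 'n::finite \<times> 'n) list" where
  "rot_indices = (SOME is. distinct is \<and> set is = {(off, j, k). j \<noteq> k})"

lemma rot_indices:
  "distinct (rot_indices :: (bool \<times> 'n::finite \<times> 'n) list)"
  "set (rot_indices :: (bool \<times> 'n \<times> 'n) list) = {(off, j, k). j \<noteq> k}"
proof -
  have "finite ({(off, j, k). j \<noteq> k} :: (bool \<times> 'n \<times> 'n) set)" by (rule finite)
  from finite_distinct_list[OF this]
  obtain "is" :: "(bool \<times> 'n \<times> 'n) list" where "set is = {(off, j, k). j \<noteq> k} \<and> distinct is"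
    by (elim exE)
  then have "distinct (rot_indices :: (bool \<times> 'n \<times> 'n) list) \<and>
      set (rot_indices :: (bool \<times> 'n \<times> 'n) list) = {(off, j, k). j \<noteq> k}"
    unfolding rot_indices_def by (intro someI) (simp only: conj_commute)
  then show "distinct (rot_indices :: (bool \<times> 'n \<times> 'n) list)"
    "set (rot_indices :: (bool \<times> 'n \<times> 'n) list) = {(off, j, k). j \<noteq> k}" by blast+
qed

lemma rot_pair_su:
  assumes "i \<in> set rot_indices" shows "fst (rot_pair i M) \<in> su" "snd (rot_pair i M) \<in> su"
  using assms by (auto simp: rot_indices rot_pair_def Let_def sqrt_abs_eq intro!: rot_su)

definition rot_commutator :: "bool \<times> 'n::finite \<times> 'n \<Rightarrow> 'n mtx \<Rightarrow> 'n mtx" where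
  "rot_commutator = (\<lambda>(off, j, k) M.
     if off then cscale (ent M j k / 2) (elem j k) - cscale (cnj (ent M j k) / 2) (elem k j)
     else cscale (\<i> * of_real (Im (ent M j j)) / of_nat CARD('n)) (elem j j - elem k k))"

text \<open>The right-hand side is the traceless anti-Hermitian part of \<open>M\<close>. An
  off-diagonal entry collects the contributions of \<open>(r, s)\<close> and \<open>(s, r)\<close>;
  on the diagonal each \<open>j\<close> is paired with all other \<open>k\<close>, so division by
  the dimension turns the subtracted terms into the average.\<close>

lemma sum_rot_commutators:
  fixes M :: "'n::finite mtx"
  shows "(\<Sum>i\<leftarrow>rot_indices. rot_commutator i M) =
    cscale (1 / 2) (M - adj M) - cscale (\<i> * of_real (Im (tr M)) / of_nat CARD('n)) 1"
proof (rule mtx_eqI)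
  fix r s
  let ?P = "{(j, k). j \<noteq> k} :: ('n \<times> 'n) set"
  have idx: "{(off, j, k). j \<noteq> k} = (UNIV :: bool set) \<times> ?P" by auto
  let ?f = "\<lambda>off (j, k). ent (rot_commutator (off, j, k) M) r s"
  have "ent (\<Sum>i\<leftarrow>rot_indices. rot_commutator i M) r s =
      (\<Sum>(off, j, k)\<in>UNIV \<times> ?P. ent (rot_commutator (off, j, k) M) r s)"
    by (subst sum_list_distinct_conv_sum_set[OF rot_indices(1)])
      (simp add: rot_indices(2) idx case_prod_beta)
  also have "\<dots> = (\<Sum>off\<in>UNIV. \<Sum>p\<in>?P. ?f off p)"
    by (subst sum.cartesian_product) (simp add: case_prod_beta)
  also have "\<dots> = (\<Sum>p\<in>?P. ?f True p) + (\<Sum>p\<in>?P. ?f False p)"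
    by (simp add: UNIV_bool add.commute)
  also have "(\<Sum>p\<in>?P. ?f True p) = (if r = s then 0 else ent M r s / 2 - cnj (ent M s r) / 2)"
  proof -
    have "?f True p = (if p = (r, s) then ent M r s / 2 else 0) - (if p = (s, r) then cnj (ent M s r) / 2 else 0)" for p
    proof -
      obtain j k where p: "p = (j, k)" by fastforce
      have "ent M j k / 2 * (if r = j \<and> s = k then 1 else 0) = (if p = (r, s) then ent M r s / 2 else 0)"
        "cnj (ent M j k) / 2 * (if r = k \<and> s = j then 1 else 0) = (if p = (s, r) then cnj (ent M s r) / 2 else 0)"
        using p by auto
      then show ?thesis by (simp add: p rot_commutator_def)
    qed
    then have "(\<Sum>p\<in>?P. ?f True p) = (\<Sum>p\<in>?P. if p = (r, s) then ent M r s / 2 else 0)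
        - (\<Sum>p\<in>?P. if p = (s, r) then cnj (ent M s r) / 2 else 0)"
      by (simp only: sum_subtractf)
    then show ?thesis by (simp add: sum.delta')
  qed
  also have "(\<Sum>p\<in>?P. ?f False p) = (\<Sum>j\<in>UNIV. \<Sum>k\<in>UNIV. ?f False (j, k))"
  proof -
    have "(\<Sum>p\<in>?P. ?f False p) = (\<Sum>p\<in>UNIV \<times> UNIV. ?f False p)"
      by (rule sum.mono_neutral_left) (auto simp: rot_commutator_def)
    then show ?thesis by (simp add: sum.cartesian_product)
  qed
  also have "\<dots> = (if r = s then \<i> * of_real (Im (ent M r r)) - \<i> * of_real (Im (tr M)) / of_nat CARD('n) else 0)"
  proof (cases "r = s")
    case True
    let ?m = "\<lambda>j. \<i> * of_real (Im (ent M j j)) / of_nat CARD('n)"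
    have "?f False (j, k) = (if r = j then ?m j else 0) - (if r = k then ?m j else 0)" for j k
      using True by (auto simp: rot_commutator_def)
    then have "(\<Sum>j\<in>UNIV. \<Sum>k\<in>UNIV. ?f False (j, k)) = of_nat CARD('n) * ?m r - (\<Sum>j\<in>UNIV. ?m j)"
      by (simp add: sum_subtractf sum.delta if_distrib[of "\<lambda>x. _ * x"] cong: if_cong)
    then show ?thesis using True by (simp add: tr_ent sum_distrib_left sum_divide_distrib)
  next
    case False
    then have "?f False (j, k) = 0" for j k by (auto simp: rot_commutator_def)
    then show ?thesis using False by (simp only: sum.neutral_const if_False)
  qed
  finally show "ent (\<Sum>i\<leftarrow>rot_indices. rot_commutator i M) r s =
      ent (cscale (1 / 2) (M - adj M) - cscale (\<i> * of_real (Im (tr M)) / of_nat CARD('n)) 1) r s"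
    by (auto simp: complex_eq_iff)
qed

context scaling
begin

lemma small_sqrt_abs:
  assumes "small 2 m" shows "small 1 (\<lambda>x. sqrt_abs (m x))"
proof -
  from assms obtain C where C: "0 \<le> C" "\<And>x. x \<in> X \<Longrightarrow> norm (m x) \<le> C * t x ^ 2"
    by (rule smallE) blast
  show ?thesis
  proof (rule smallI)
    fix x assume x: "x \<in> X"
    have "sqrt (norm (m x)) \<le> sqrt (C * t x ^ 2)" using C(2)[OF x] by simp
    then show "norm (sqrt_abs (m x)) \<le> sqrt C * t x ^ 1"
      using t_nonneg[OF x] by (simp add: sqrt_abs_eq real_sqrt_mult)
  qed
qed

lemma small_half_quot: "small 2 m \<Longrightarrow> small 1 (\<lambda>x. half_quot (m x))"
  by (rule small_le[OF small_sqrt_abs _], assumption, rule norm_half_quot)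

lemma small_cscale_elem: "small k c \<Longrightarrow> small k (\<lambda>x. cscale (c x) A)"
  using small_cscale[OF _ small_const, of k c A] by simp

lemma small_gen:
  assumes "small 1 z" "small 1 b" shows "small 1 (\<lambda>x. gen j k (z x) (b x))"
proof -
  have "small 1 (\<lambda>x. \<i> * z x)" using small_bounded_mult(1)[OF small_const assms(1)] .
  moreover have "small 1 (\<lambda>x. cnj (b x))" using assms(2) by (simp add: small_def)
  ultimately show ?thesis
    unfolding gen_def using assms by (intro small_add small_diff small_cscale_elem)
qed

text \<open>Normalisation costs only the factor \<open>c\<close>, and \<open>c - 1\<close> is of
  second order because \<open>z\<close> and \<open>b\<close> enter it through their squared
  moduli.\<close>

lemma small_rot:
  assumes z: "small 1 z" and b: "small 1 b" and real: "\<And>x. cnj (z x) = z x"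
  shows "small 2 (\<lambda>x. rot j k (z x) (b x) - 1 - gen j k (z x) (b x))"
proof -
  define c where "c = (\<lambda>x. inverse (csqrt (1 + z x * cnj (z x) + b x * cnj (b x))))"
  have c: "c x = of_real (inverse (sqrt (1 + ((norm (z x))\<^sup>2 + (norm (b x))\<^sup>2))))" for x
    unfolding c_def csqrt_one_plus by (simp add: add.assoc)
  have "small (1 + 1) (\<lambda>x. norm (z x) * norm (z x))" "small (1 + 1) (\<lambda>x. norm (b x) * norm (b x))"
    using z b by (intro small_mult; simp add: small_def)+
  then have "small 2 (\<lambda>x. (norm (z x))\<^sup>2 + (norm (b x))\<^sup>2)"
    unfolding power2_eq_square one_add_one by (rule small_add)
  then have c1: "small 2 (\<lambda>x. c x - 1)"
  proof (rule small_le)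
    fix x
    have "c x - 1 = of_real (inverse (sqrt (1 + ((norm (z x))\<^sup>2 + (norm (b x))\<^sup>2))) - 1)"
      unfolding c by simp
    then have "norm (c x - 1) = \<bar>inverse (sqrt (1 + ((norm (z x))\<^sup>2 + (norm (b x))\<^sup>2))) - 1\<bar>"
      by (simp only: norm_of_real)
    also have "\<dots> \<le> (norm (z x))\<^sup>2 + (norm (b x))\<^sup>2" by (rule one_minus_inverse_sqrt) simp
    finally show "norm (c x - 1) \<le> norm ((norm (z x))\<^sup>2 + (norm (b x))\<^sup>2)" by simp
  qed
  have c_fold: "inverse (csqrt (1 + z x * cnj (z x) + b x * cnj (b x))) = c x" for x
    by (simp only: c_def)
  have ccnj: "cnj (c x) = c x" for x by (simp add: c)
  have bdd: "small 0 z" "small 0 b" "small 0 (\<lambda>x. cnj (b x))"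
    using small_weaken[OF z, of 0] small_weaken[OF b, of 0] by (simp_all add: small_def)
  have "small 2 (\<lambda>x. cscale ((1 + \<i> * z x) * (c x - 1)) (elem j j) + cscale ((1 - \<i> * z x) * (c x - 1)) (elem k k)
      + cscale (b x * (c x - 1)) (elem j k) - cscale (cnj (b x) * (c x - 1)) (elem k j))"
    by (intro small_add small_diff small_cscale_elem small_bounded_mult(1)[OF _ c1] bdd small_const
        small_bounded_mult(1)[OF small_const bdd(1)])
  then show ?thesis
  proof (rule small_cong)
    fix x
    have coeff: "c x * (1 + \<i> * z x) - 1 = (1 + \<i> * z x) * (c x - 1) + \<i> * z x"
      "cnj (c x * (1 + \<i> * z x)) - 1 = (1 - \<i> * z x) * (c x - 1) - \<i> * z x"
      "c x * b x = b x * (c x - 1) + b x" "cnj (c x * b x) = cnj (b x) * (c x - 1) + cnj (b x)"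
      by (simp_all add: ccnj real algebra_simps)
    show "cscale ((1 + \<i> * z x) * (c x - 1)) (elem j j) + cscale ((1 - \<i> * z x) * (c x - 1)) (elem k k)
      + cscale (b x * (c x - 1)) (elem j k) - cscale (cnj (b x) * (c x - 1)) (elem k j) =
      rot j k (z x) (b x) - 1 - gen j k (z x) (b x)"
      unfolding rot_def Let_def c_fold two_level_def gen_def
      by (simp only: coeff(1,2,4), simp only: coeff(3), simp only: cscale_left, simp)
  qed
qed

end

text \<open>\<open>U\<close> comes last and yields the current approximation \<open>u\<close>; the
  commutators before it produce \<open>U * adj u\<close> approximately.\<close>

definition step_targets :: "'n::finite mtx \<Rightarrow> 'n mtx \<Rightarrow> 'n mtx list" where
  "step_targets U u = concat (map (\<lambda>i. commutator_targets (fst (rot_pair i (U * adj u - 1)))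
     (snd (rot_pair i (U * adj u - 1)))) rot_indices) @ [U]"

lemma set_step_targets: "U \<in> su \<Longrightarrow> set (step_targets U u) \<subseteq> su"
proof -
  assume U: "U \<in> su"
  have c: "set (commutator_targets V W) \<subseteq> su" if "V \<in> su" "W \<in> su" for V W :: "'a mtx"
    using that set_inverse_targets[OF that(1)] set_inverse_targets[OF that(2)]
    by (simp add: commutator_targets_def)
  show ?thesis
    unfolding step_targets_def by (simp add: U UN_subset_iff c rot_pair_su)
qed

context scaling
begin

text \<open>Unitarity of \<open>1 + M\<close> makes \<open>M + adj M\<close> equal to minus
  \<open>M * adj M\<close>, which is of fourth order, and \<open>small_tr_su\<close> does the same
  for the trace. So \<open>M\<close> is almost its own traceless anti-Hermitian part.\<close>

lemma small_sum_rot_commutators: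
  fixes M :: "'x \<Rightarrow> 'n::finite mtx"
  assumes M: "small 2 M" and su: "\<And>x. x \<in> X \<Longrightarrow> 1 + M x \<in> su"
  shows "small 4 (\<lambda>x. (\<Sum>i\<leftarrow>rot_indices. rot_commutator i (M x)) - M x)"
proof -
  have "small (2 + 2) (\<lambda>x. M x * adj (M x))" by (intro small_mult small_adj M)
  then have herm: "small 4 (\<lambda>x. M x * adj (M x))" by simp
  have tr: "small 4 (\<lambda>x. tr (M x))" using small_tr_su[OF M su] by simp
  then have "small 4 (\<lambda>x. of_real (Im (tr (M x))) :: complex)"
    by (rule small_le) (simp add: abs_Im_le_cmod)
  from small_bounded_mult(1)[OF small_const[of "\<i> / of_nat CARD('n)"] this]
  have "small 4 (\<lambda>x. \<i> * of_real (Im (tr (M x))) / of_nat CARD('n))" by simp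
  then have "small 4 (\<lambda>x. cscale (1 / 2) (M x * adj (M x)) -
      cscale (\<i> * of_real (Im (tr (M x))) / of_nat CARD('n)) 1)"
    using small_cscale[OF small_const herm, of "1 / 2"]
    by (intro small_diff small_cscale_elem) simp_all
  then show ?thesis
  proof (rule small_cong)
    fix x assume x: "x \<in> X"
    have "(1 + M x) * adj (1 + M x) = 1" using su[OF x] by (rule su_adj_mult)
    then have MM: "M x * adj (M x) = - (M x + adj (M x))"
      by (simp add: algebra_simps eq_neg_iff_add_eq_0)
    have "cscale (1 / 2) (M x * adj (M x)) = cscale (1 / 2) (M x - adj (M x)) - M x"
      unfolding MM by (rule mtx_eqI) (simp add: field_simps)
    then show "cscale (1 / 2) (M x * adj (M x)) -
        cscale (\<i> * of_real (Im (tr (M x))) / of_nat CARD('n)) 1 =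
      (\<Sum>i\<leftarrow>rot_indices. rot_commutator i (M x)) - M x"
      unfolding sum_rot_commutators by simp
  qed
qed

lemma small_rot_commutator:
  fixes M :: "'x \<Rightarrow> 'n::finite mtx"
  assumes M: "small 2 M" shows "small 2 (\<lambda>x. rot_commutator i (M x))"
proof -
  obtain off j k where i: "i = (off, j, k)" by (cases i) auto
  have m: "small 2 (\<lambda>x. ent (M x) a b / 2)" "small 2 (\<lambda>x. cnj (ent (M x) a b) / 2)" for a b
    using small_bounded_mult(1)[OF small_const[of "1 / 2"] small_ent[OF M, of a b]]
    by (simp_all add: small_def norm_divide)
  have "small 2 (\<lambda>x. of_real (Im (ent (M x) j j)) :: complex)"
    by (rule small_le[OF small_ent[OF M, of j j]]) (simp add: abs_Im_le_cmod)
  from small_bounded_mult(1)[OF small_const[of "\<i> / of_nat CARD('n)"] this]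
  have "small 2 (\<lambda>x. \<i> * of_real (Im (ent (M x) j j)) / of_nat CARD('n))" by simp
  then show ?thesis
    using m by (cases off) (simp_all add: i rot_commutator_def small_cscale_elem small_diff del: cscale_simps)
qed

lemma rot_pair_generators:
  fixes M :: "'x \<Rightarrow> 'n::finite mtx"
  assumes M: "small 2 M" and i: "i \<in> set rot_indices"
  obtains K L where "small 1 K" "small 1 L"
    "small 2 (\<lambda>x. fst (rot_pair i (M x)) - 1 - K x)" "small 2 (\<lambda>x. snd (rot_pair i (M x)) - 1 - L x)"
    "\<And>x. K x * L x - L x * K x = rot_commutator i (M x)"
proof -
  obtain off j k where ijk: "i = (off, j, k)" "j \<noteq> k" using i by (auto simp: rot_indices)
  show ?thesis
  proof (cases off)
    case True
    let ?z = "\<lambda>x. sqrt_abs (ent (M x) j k)" and ?b = "\<lambda>x. - \<i> / 2 * half_quot (ent (M x) j k)"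
    have z: "small 1 ?z" by (intro small_sqrt_abs small_ent M)
    have b: "small 1 ?b" by (intro small_bounded_mult(1)[OF small_const] small_half_quot small_ent M)
    \<comment> \<open>The parameters in \<open>rot_pair\<close> come from these equations: the
      factor \<open>- \<i> / 2\<close> cancels \<open>2 * \<i>\<close>, and \<open>sqrt_abs\<close>
      times \<open>half_quot\<close> leaves half the entry.\<close>
    have half: "2 * \<i> * ?z x * ?b x = ent (M x) j k / 2"
      "2 * \<i> * ?z x * cnj (?b x) = - cnj (ent (M x) j k) / 2" for x
    proof -
      have h: "sqrt_abs (ent (M x) j k) * half_quot (ent (M x) j k) = ent (M x) j k / 2"
        by (rule sqrt_abs_half_quot)
      have "2 * \<i> * ?z x * ?b x = sqrt_abs (ent (M x) j k) * half_quot (ent (M x) j k)"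
        by (simp add: algebra_simps)
      with h show "2 * \<i> * ?z x * ?b x = ent (M x) j k / 2" by simp
      have "2 * \<i> * ?z x * cnj (?b x) = - cnj (sqrt_abs (ent (M x) j k) * half_quot (ent (M x) j k))"
        by (simp add: algebra_simps sqrt_abs_eq)
      then show "2 * \<i> * ?z x * cnj (?b x) = - cnj (ent (M x) j k) / 2" unfolding h by simp
    qed
    show ?thesis
    proof
      show "small 1 (\<lambda>x. gen j k (?z x) 0)" "small 1 (\<lambda>x. gen j k 0 (?b x))"
        by (intro small_gen z b small_zero)+
      show "small 2 (\<lambda>x. fst (rot_pair i (M x)) - 1 - gen j k (?z x) 0)"
        using small_rot[OF z small_zero] True by (simp add: ijk rot_pair_def sqrt_abs_eq)
      show "small 2 (\<lambda>x. snd (rot_pair i (M x)) - 1 - gen j k 0 (?b x))"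
        using small_rot[OF small_zero b] True by (simp add: ijk rot_pair_def)
      show "gen j k (?z x) 0 * gen j k 0 (?b x) - gen j k 0 (?b x) * gen j k (?z x) 0 =
          rot_commutator i (M x)" for x
        unfolding gen_commutator_off[OF ijk(2)] half using True
        by (auto simp: ijk rot_commutator_def intro!: mtx_eqI)
    qed
  next
    case False
    let ?m = "\<lambda>x. (ent (M x) j j - cnj (ent (M x) j j)) * inverse (2 * \<i> * of_nat CARD('n))"
    have m_eq: "?m x = of_real (Im (ent (M x) j j) / of_nat CARD('n))" for x
      by (simp add: complex_diff_cnj field_simps)
    have m: "small 2 ?m"
      by (intro small_bounded_mult(2)[OF small_const] small_diff small_ent M)
        (use small_ent[OF M] in \<open>simp add: small_def\<close>)
    let ?a = "\<lambda>x. sqrt_abs (?m x)" and ?b = "\<lambda>x. \<i> * half_quot (?m x)"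
    have a: "small 1 ?a" by (intro small_sqrt_abs m)
    have b: "small 1 ?b" by (intro small_bounded_mult(1)[OF small_const] small_half_quot m)
    \<comment> \<open>Only the imaginary part of the diagonal entry is used, so \<open>?m x\<close>
      is real; its half and the conjugate of that half add up to \<open>?m x\<close>.\<close>
    have diff: "?b x * cnj (?a x) - ?a x * cnj (?b x) = \<i> * ?m x" for x
    proof -
      let ?h = "sqrt_abs (?m x) * half_quot (?m x)"
      have ra: "cnj (?a x) = ?a x" by (simp add: sqrt_abs_eq)
      have "?b x * cnj (?a x) - ?a x * cnj (?b x) = \<i> * (?h + cnj ?h)"
        unfolding ra complex_cnj_mult by (simp add: algebra_simps)
      also have "?h + cnj ?h = ?m x"
        unfolding sqrt_abs_half_quot unfolding m_eq by simp
      finally show ?thesis .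
    qed
    show ?thesis
    proof
      show "small 1 (\<lambda>x. gen j k 0 (?a x))" "small 1 (\<lambda>x. gen j k 0 (?b x))"
        by (intro small_gen a b small_zero)+
      show "small 2 (\<lambda>x. fst (rot_pair i (M x)) - 1 - gen j k 0 (?a x))"
        using small_rot[OF small_zero a] False by (simp add: ijk rot_pair_def Let_def)
      show "small 2 (\<lambda>x. snd (rot_pair i (M x)) - 1 - gen j k 0 (?b x))"
        using small_rot[OF small_zero b] False by (simp add: ijk rot_pair_def Let_def)
      show "gen j k 0 (?a x) * gen j k 0 (?b x) - gen j k 0 (?b x) * gen j k 0 (?a x) =
          rot_commutator i (M x)" for x
        unfolding gen_commutator_diag[OF ijk(2)] diff unfolding m_eq
        using False by (simp add: ijk rot_commutator_def del: cscale_simps)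
    qed
  qed
qed

end

context approximators
begin

lemma small_step_targets:
  assumes U: "\<And>x. x \<in> X \<Longrightarrow> U x \<in> su"
  shows "small 3 (\<lambda>x. prod_list (map (A x) (step_targets (U x) (A x (U x)))) - U x)"
proof -
  define u where "u = (\<lambda>x. A x (U x))"
  define M where "M = (\<lambda>x. U x * adj (u x) - 1)"
  have u: "u x \<in> su" if "x \<in> X" for x using that by (simp add: u_def A_su U)
  have "small 2 (\<lambda>x. - ((u x - U x) * adj (u x)))"
    unfolding u_def
    by (intro small_minus small_bounded_mult(2) A_small small_su su_adj A_su U)
  then have M: "small 2 M"
    by (rule small_cong) (simp add: M_def u left_diff_distrib)
  have M_su: "1 + M x \<in> su" if "x \<in> X" for x
    using that by (auto simp: M_def intro: U u)
  let ?f = "\<lambda>i x. prod_list (map (A x) (commutator_targets (fst (rot_pair i (M x))) (snd (rot_pair i (M x)))))"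
  have f: "small 3 (\<lambda>x. ?f i x - 1 - rot_commutator i (M x))" if i: "i \<in> set rot_indices" for i
  proof -
    obtain K L where K: "small 1 K" "small 1 L"
      "small 2 (\<lambda>x. fst (rot_pair i (M x)) - 1 - K x)" "small 2 (\<lambda>x. snd (rot_pair i (M x)) - 1 - L x)"
      and KL: "\<And>x. K x * L x - L x * K x = rot_commutator i (M x)"
      by (rule rot_pair_generators[OF M i]) blast
    show ?thesis
      unfolding KL[symmetric] by (intro small_commutator_targets K rot_pair_su i)
  qed
  have "small 3 (\<lambda>x. (\<Prod>i\<leftarrow>rot_indices. ?f i x) - 1 - (\<Sum>i\<leftarrow>rot_indices. rot_commutator i (M x)))"
    by (intro small_prod_list_first_order f small_rot_commutator M)
  from small_add[OF this small_weaken[OF small_sum_rot_commutators[OF M M_su]]]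
  have P: "small 3 (\<lambda>x. (\<Prod>i\<leftarrow>rot_indices. ?f i x) - 1 - M x)" by simp
  have "small 3 (\<lambda>x. ((\<Prod>i\<leftarrow>rot_indices. ?f i x) - 1 - M x) * u x)"
    by (intro small_bounded_mult(2)[OF _ P] small_su u)
  then show ?thesis
  proof (rule small_cong)
    fix x assume x: "x \<in> X"
    have "prod_list (map (A x) (concat (map (\<lambda>i. commutator_targets (fst (rot_pair i (M x))) (snd (rot_pair i (M x)))) is)))
        = (\<Prod>i\<leftarrow>is. ?f i x)" for "is"
      by (induction "is") auto
    then have "prod_list (map (A x) (step_targets (U x) (u x))) = (\<Prod>i\<leftarrow>rot_indices. ?f i x) * u x"
      by (simp add: step_targets_def M_def u_def)
    moreover have "(1 + M x) * u x = U x" using u[OF x] by (simp add: M_def mult.assoc)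
    ultimately show "((\<Prod>i\<leftarrow>rot_indices. ?f i x) - 1 - M x) * u x =
        prod_list (map (A x) (step_targets (U x) (A x (U x)))) - U x"
      by (simp add: algebra_simps u_def)
  qed
qed

end

lemma step_targets_error:
  obtains C where "0 < C"
    "\<And>\<tau> U A. 0 \<le> \<tau> \<Longrightarrow> \<tau> \<le> 1 \<Longrightarrow> U \<in> su \<Longrightarrow>
       (\<And>V. V \<in> su \<Longrightarrow> A V \<in> su \<and> norm (A V - V) \<le> \<tau>\<^sup>2) \<Longrightarrow>
       norm (prod_list (map A (step_targets U (A U))) - (U :: 'n::finite mtx)) \<le> C * \<tau> ^ 3"
proof -
  let ?X = "{(\<tau>, U, A). 0 \<le> \<tau> \<and> \<tau> \<le> 1 \<and> U \<in> su \<and> (\<forall>V\<in>su. A V \<in> su \<and> norm (A V - V) \<le> \<tau>\<^sup>2)}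
    :: (real \<times> 'n mtx \<times> ('n mtx \<Rightarrow> 'n mtx)) set"
  interpret approximators ?X fst "\<lambda>(_, _, A). A" by standard auto
  have "small 3 (\<lambda>x. prod_list (map ((\<lambda>(_, _, A). A) x) (step_targets (fst (snd x)) ((\<lambda>(_, _, A). A) x (fst (snd x))))) - fst (snd x))"
    by (rule small_step_targets) auto
  then obtain C where C: "0 \<le> C" "\<And>x. x \<in> ?X \<Longrightarrow> norm (prod_list (map ((\<lambda>(_, _, A). A) x)
      (step_targets (fst (snd x)) ((\<lambda>(_, _, A). A) x (fst (snd x))))) - fst (snd x)) \<le> C * fst x ^ 3"
    by (rule smallE) blast
  show ?thesis
  proof
    show "0 < C + 1" using C(1) by simp
    fix \<tau> :: real and U :: "'n mtx" and A :: "'n mtx \<Rightarrow> 'n mtx"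
    assume *: "0 \<le> \<tau>" "\<tau> \<le> 1" "U \<in> su" "\<And>V. V \<in> su \<Longrightarrow> A V \<in> su \<and> norm (A V - V) \<le> \<tau>\<^sup>2"
    then have "norm (prod_list (map A (step_targets U (A U))) - U) \<le> C * \<tau> ^ 3"
      using C(2)[of "(\<tau>, U, A)"] by simp
    also have "\<dots> \<le> (C + 1) * \<tau> ^ 3" using * by (simp add: mult_right_mono)
    finally show "norm (prod_list (map A (step_targets U (A U))) - U) \<le> (C + 1) * \<tau> ^ 3" .
  qed
qed

section \<open>The program and its cost\<close>

text \<open>The program keeps the target in matrix register 1 and its current approximation in register 2.\<close>

definition mexpressible :: "('n::finite mtx \<Rightarrow> 'n mtx \<Rightarrow> 'n mtx) \<Rightarrow> bool" where
  "mexpressible f \<longleftrightarrow> (\<exists>e. \<forall>s. mval e s = mat_of (f (Mtx (mreg s 1)) (Mtx (mreg s 2))))"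

definition sexpressible :: "('n::finite mtx \<Rightarrow> 'n mtx \<Rightarrow> complex) \<Rightarrow> bool" where
  "sexpressible f \<longleftrightarrow> (\<exists>e. \<forall>s. sval e s = f (Mtx (mreg s 1)) (Mtx (mreg s 2)))"

text \<open>The list \<open>es\<close> is independent of the state, so the number of recursive calls
  is fixed and they can be unrolled in one program for all targets.\<close>

definition lexpressible :: "('n::finite mtx \<Rightarrow> 'n mtx \<Rightarrow> 'n mtx list) \<Rightarrow> bool" where
  "lexpressible f \<longleftrightarrow> (\<exists>es. \<forall>s. map (\<lambda>e. mval e s) es = map mat_of (f (Mtx (mreg s 1)) (Mtx (mreg s 2))))"

section \<open>Expressibility of the targets\<close>

lemma sexpressible_intros:
  "sexpressible (\<lambda>U u. of_int n)"
  "sexpressible (\<lambda>U u. \<i>)"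
  "sexpressible x \<Longrightarrow> sexpressible y \<Longrightarrow> sexpressible (\<lambda>U u. x U u + y U u)"
  "sexpressible x \<Longrightarrow> sexpressible y \<Longrightarrow> sexpressible (\<lambda>U u. x U u * y U u)"
  "sexpressible x \<Longrightarrow> sexpressible (\<lambda>U u. inverse (x U u))"
  "sexpressible x \<Longrightarrow> sexpressible (\<lambda>U u. cnj (x U u))"
  "sexpressible x \<Longrightarrow> sexpressible (\<lambda>U u. csqrt (x U u))"
  "mexpressible f \<Longrightarrow> sexpressible (\<lambda>U u. ent (f U u) i j)"
  unfolding sexpressible_def mexpressible_def
  by (metis sval.simps(2), metis sval.simps(3), metis sval.simps(4), metis sval.simps(5),
      metis sval.simps(6), metis sval.simps(7), metis sval.simps(8), metis sval.simps(9) mat_of_nth)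

lemma mexpressible_intros:
  "mexpressible (\<lambda>U u. U)"
  "mexpressible (\<lambda>U u. u)"
  "mexpressible (\<lambda>U u. elem i j)"
  "mexpressible f \<Longrightarrow> mexpressible g \<Longrightarrow> mexpressible (\<lambda>U u. f U u + g U u)"
  "mexpressible f \<Longrightarrow> mexpressible g \<Longrightarrow> mexpressible (\<lambda>U u. f U u * g U u)"
  "sexpressible x \<Longrightarrow> mexpressible f \<Longrightarrow> mexpressible (\<lambda>U u. cscale (x U u) (f U u))"
  "mexpressible f \<Longrightarrow> mexpressible (\<lambda>U u. adj (f U u))"
  unfolding sexpressible_def mexpressible_def
proof -
  show "\<exists>e. \<forall>s. mval e s = mat_of (Mtx (mreg s 1))" "\<exists>e. \<forall>s. mval e s = mat_of (Mtx (mreg s 2))"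
    by (metis mval.simps(1) Mtx_inverse UNIV_I)+
  show "\<exists>e. \<forall>s. mval e s = mat_of (elem i j)"
    by (metis mval.simps(2) elem.rep_eq)
qed (metis mval.simps(3) plus_mtx.rep_eq, metis mval.simps(4) times_mtx.rep_eq,
    metis mval.simps(5) cscale.rep_eq, metis mval.simps(6) adj.rep_eq)

lemma sexpressible_neg_one: "sexpressible (\<lambda>U u. - 1)"
  using sexpressible_intros(1)[of "-1"] by simp

lemma sexpressible_one: "sexpressible (\<lambda>U u. 1)"
  using sexpressible_intros(1)[of 1] by simp

lemma sexpressible_zero: "sexpressible (\<lambda>U u. 0)"
  using sexpressible_intros(1)[of 0] by simp

lemma sexpressible_minus: "sexpressible x \<Longrightarrow> sexpressible (\<lambda>U u. - x U u)"
  using sexpressible_intros(4)[OF sexpressible_neg_one] by simp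

lemma sexpressible_diff: "sexpressible x \<Longrightarrow> sexpressible y \<Longrightarrow> sexpressible (\<lambda>U u. x U u - y U u)"
  using sexpressible_intros(3)[OF _ sexpressible_minus, of x y] by simp

lemma mexpressible_diff:
  assumes "mexpressible f" "mexpressible g" shows "mexpressible (\<lambda>U u. f U u - g U u)"
proof -
  have "f U u + cscale (- 1) (g U u) = f U u - g U u" for U u by (rule mtx_eqI) simp
  then show ?thesis
    using mexpressible_intros(4)[OF assms(1) mexpressible_intros(6)[OF sexpressible_neg_one assms(2)]]
    by simp
qed

lemma mexpressible_sum:
  assumes "\<And>i. i \<in> I \<Longrightarrow> mexpressible (f i)" shows "mexpressible (\<lambda>U u. \<Sum>i\<in>I. f i U u)"
proof -
  have "mexpressible (\<lambda>U u. cscale 0 U)"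
    by (intro mexpressible_intros sexpressible_zero)
  then have "mexpressible (\<lambda>U u. 0)" by simp
  with assms show ?thesis
    by (induction I rule: infinite_finite_induct) (auto intro: mexpressible_intros)
qed

text \<open>The matrix is assembled from matrix units, with coefficients built from the available
  literals.\<close>

lemma mexpressible_const:
  assumes "A \<in> gauss_su" shows "mexpressible (\<lambda>U u. A)"
proof -
  have "A = (\<Sum>i\<in>UNIV. \<Sum>j\<in>UNIV. cscale (ent A i j) (elem i j))"
  proof (rule mtx_eqI)
    fix r s
    have "(\<Sum>j\<in>UNIV. ent A i j * (if r = i \<and> s = j then 1 else 0)) = (if r = i then ent A i s else 0)" for i
      by (auto simp: if_distrib cong: if_cong)
    then show "ent A r s = ent (\<Sum>i\<in>UNIV. \<Sum>j\<in>UNIV. cscale (ent A i j) (elem i j)) r s"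
      by simp
  qed
  moreover have "sexpressible (\<lambda>U u. ent A i j)" for i j
  proof -
    have "Re (ent A i j) \<in> \<int>" "Im (ent A i j) \<in> \<int>" using assms by (simp_all add: gauss_su_def)
    then obtain a b where "Re (ent A i j) = of_int a" "Im (ent A i j) = of_int b"
      by (elim Ints_cases)
    then have "ent A i j = of_int a + \<i> * of_int b" by (simp add: complex_eq_iff)
    moreover have "sexpressible (\<lambda>U u. of_int a + \<i> * of_int b)" by (intro sexpressible_intros)
    ultimately show ?thesis by simp
  qed
  then have "mexpressible (\<lambda>U u. \<Sum>i\<in>UNIV. \<Sum>j\<in>UNIV. cscale (ent A i j) (elem i j))"
    by (intro mexpressible_sum mexpressible_intros)
  ultimately show ?thesis by simp
qed

lemma mexpressible_rot:
  assumes "sexpressible z" "sexpressible b"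
  shows "mexpressible (\<lambda>U u. rot j k (z U u) (b U u))"
  unfolding rot_def Let_def two_level_def
  by (intro mexpressible_intros mexpressible_diff mexpressible_const[OF gauss_su_one]
      sexpressible_diff sexpressible_one sexpressible_intros assms)

lemma lexpressible_Nil: "lexpressible (\<lambda>U u. [])"
  unfolding lexpressible_def by (rule exI[of _ "[]"]) simp

lemma lexpressible_Cons:
  assumes "mexpressible f" "lexpressible g" shows "lexpressible (\<lambda>U u. f U u # g U u)"
proof -
  from assms obtain e es where "\<And>s. mval e s = mat_of (f (Mtx (mreg s 1)) (Mtx (mreg s 2)))"
    "\<And>s. map (\<lambda>e. mval e s) es = map mat_of (g (Mtx (mreg s 1)) (Mtx (mreg s 2)))"
    unfolding mexpressible_def lexpressible_def by blast
  then show ?thesis unfolding lexpressible_def by (intro exI[of _ "e # es"]) simp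
qed

lemma lexpressible_append:
  assumes "lexpressible f" "lexpressible g" shows "lexpressible (\<lambda>U u. f U u @ g U u)"
proof -
  from assms obtain es es' where "\<And>s. map (\<lambda>e. mval e s) es = map mat_of (f (Mtx (mreg s 1)) (Mtx (mreg s 2)))"
    "\<And>s. map (\<lambda>e. mval e s) es' = map mat_of (g (Mtx (mreg s 1)) (Mtx (mreg s 2)))"
    unfolding lexpressible_def by blast
  then show ?thesis unfolding lexpressible_def by (intro exI[of _ "es @ es'"]) simp
qed

lemma lexpressible_concat:
  "(\<And>i. i \<in> set is \<Longrightarrow> lexpressible (f i)) \<Longrightarrow> lexpressible (\<lambda>U u. concat (map (\<lambda>i. f i U u) is))"
  by (induction "is") (auto intro: lexpressible_Nil lexpressible_append)

lemma lexpressible_inverse_targets: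
  assumes "mexpressible V" shows "lexpressible (\<lambda>U u. inverse_targets (V U u))"
  unfolding inverse_targets_def
proof (intro lexpressible_Cons lexpressible_concat)
  fix h :: "'a mtx" assume "h \<in> set correction"
  then have "mexpressible (\<lambda>U u :: 'a mtx. h)" using set_correction by (intro mexpressible_const) auto
  then show "lexpressible (\<lambda>U u. if h = 1 then [V U u, adj (V U u)] else [h])"
    using assms by (cases "h = 1")
      (simp_all add: lexpressible_Nil lexpressible_Cons mexpressible_intros)
qed (intro mexpressible_intros assms)

lemma lexpressible_step_targets: "lexpressible (step_targets :: 'n::finite mtx \<Rightarrow> _)"
proof -
  have M: "mexpressible (\<lambda>U u. U * adj u - 1)"
    by (intro mexpressible_intros mexpressible_diff mexpressible_const gauss_su_one)
  have abs: "sexpressible (\<lambda>U u. sqrt_abs (x U u))" if "sexpressible x" for x :: "'n mtx \<Rightarrow> 'n mtx \<Rightarrow> complex"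
    unfolding sqrt_abs_def by (intro sexpressible_intros that)
  have two: "sexpressible (\<lambda>U u. 2)"
    using sexpressible_intros(1)[of 2] by simp
  have hq: "sexpressible (\<lambda>U u. half_quot (x U u))" if "sexpressible x" for x :: "'n mtx \<Rightarrow> 'n mtx \<Rightarrow> complex"
    unfolding half_quot_def by (intro sexpressible_intros abs two that)
  have half: "sexpressible (\<lambda>U u. - \<i> / 2)"
    unfolding divide_inverse by (intro sexpressible_intros sexpressible_minus two)
  have card: "sexpressible (\<lambda>U u. of_nat CARD('n))"
    using sexpressible_intros(1)[of "int CARD('n)"] by simp
  have pair: "mexpressible (\<lambda>U u. fst (rot_pair i (U * adj u - 1))) \<and>
      mexpressible (\<lambda>U u. snd (rot_pair i (U * adj u - 1)))" for i :: "bool \<times> 'n \<times> 'n"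
  proof -
    obtain off j k where i: "i = (off, j, k)" by (cases i) auto
    have m: "sexpressible (\<lambda>U u. ent (U * adj u - 1) a b)" for a b :: 'n
      by (intro sexpressible_intros M)
    have d: "sexpressible (\<lambda>U u. (ent (U * adj u - 1) j j - cnj (ent (U * adj u - 1) j j)) *
        inverse (2 * \<i> * of_nat CARD('n)))"
      by (intro sexpressible_intros sexpressible_diff m two card)
    show ?thesis
    proof (cases off)
      case True
      then have eq: "rot_pair i M = (rot j k (sqrt_abs (ent M j k)) 0,
          rot j k 0 (- \<i> / 2 * half_quot (ent M j k)))" for M
        by (simp add: i rot_pair_def)
      show ?thesis unfolding eq fst_conv snd_conv
        by (intro conjI mexpressible_rot abs hq sexpressible_zero sexpressible_intros(4) half m)
    next
      case False
      then have eq: "rot_pair i M =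
          (rot j k 0 (sqrt_abs ((ent M j j - cnj (ent M j j)) * inverse (2 * \<i> * of_nat CARD('n)))),
           rot j k 0 (\<i> * half_quot ((ent M j j - cnj (ent M j j)) * inverse (2 * \<i> * of_nat CARD('n)))))" for M
        by (simp only: i rot_pair_def Let_def case_prod_conv if_False)
      show ?thesis unfolding eq fst_conv snd_conv
        by (intro conjI mexpressible_rot abs hq sexpressible_zero sexpressible_intros(2,4) d)
    qed
  qed
  have "lexpressible (\<lambda>U u :: 'n mtx. concat (map (\<lambda>i. commutator_targets (fst (rot_pair i (U * adj u - 1)))
     (snd (rot_pair i (U * adj u - 1)))) rot_indices) @ [U])"
    unfolding commutator_targets_def
    by (intro lexpressible_append lexpressible_concat lexpressible_Cons lexpressible_Nil
        lexpressible_inverse_targets conjunct1[OF pair] conjunct2[OF pair] mexpressible_intros(1))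
  then show ?thesis unfolding step_targets_def .
qed

text \<open>The condition ranges over all states with the given contents of registers 0, so the word
  depends on target and precision only.\<close>

definition runs :: "('n::finite cmat \<Rightarrow> 'n cmat list) \<Rightarrow> ('n, 'n cmat) com list \<Rightarrow>
    'n cmat \<Rightarrow> real \<Rightarrow> 'n cmat list \<Rightarrow> nat \<Rightarrow> bool" where
  "runs orc P U \<delta> w T \<longleftrightarrow> (\<forall>s. mreg s 0 = U \<longrightarrow> sreg s 0 = of_real \<delta> \<longrightarrow>
     (\<exists>t s'. exec orc P (P ! 0) s t s' \<and> wreg s' 0 = w \<and> t \<le> T))"

lemma runs_mono:
  fixes P :: "('n::finite, 'n cmat) com list"
  assumes "runs orc P U \<delta> w T" "T \<le> T'" shows "runs orc P U \<delta> w T'"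
  unfolding runs_def
proof (intro allI impI)
  fix s :: "'n state" assume "mreg s 0 = U" "sreg s 0 = complex_of_real \<delta>"
  then obtain t s' where "exec orc P (P ! 0) s t s'" "wreg s' 0 = w" "t \<le> T"
    using assms(1) unfolding runs_def by blast
  moreover from \<open>t \<le> T\<close> assms(2) have "t \<le> T'" by (rule order_trans)
  ultimately show "\<exists>t s'. exec orc P (P ! 0) s t s' \<and> wreg s' 0 = w \<and> t \<le> T'"
    by (intro exI conjI)
qed

text \<open>This keeps the target, its approximation, the precision and the collected word alive
  across the recursion, outside register 0.\<close>

lemma exec_call:
  assumes "runs orc P U \<delta> w T" "P \<noteq> []" "mreg s 0 = U" "sreg s 0 = of_real \<delta>"
  obtains t s' where "exec orc P (Call 0) s t s'" "t \<le> 1 + T" "wreg s' 0 = w"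
    "\<And>r. r \<noteq> 0 \<Longrightarrow> mreg s' r = mreg s r" "\<And>r. r \<noteq> 0 \<Longrightarrow> sreg s' r = sreg s r"
    "\<And>r. r \<noteq> 0 \<Longrightarrow> wreg s' r = wreg s r"
proof -
  obtain t s' where "exec orc P (P ! 0) s t s'" "wreg s' 0 = w" "t \<le> T"
    using assms unfolding runs_def by blast
  then show ?thesis
    using assms(2) by (intro that[OF exec.Call[of 0 P orc s t s']]) auto
qed

text \<open>The precision is reloaded before each call because the previous call has overwritten
  scalar register 0.\<close>

primrec call_all :: "'n mexp list \<Rightarrow> ('n, 'g) com" where
  "call_all [] = Skip"
| "call_all (e # es) = Seq (SetM 0 e) (Seq (SetS 0 (SReg 1)) (Seq (Call 0) (Seq (Append 1 1 0) (call_all es))))"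

lemma exec_call_all:
  fixes es :: "'n::finite mexp list"
  assumes P: "P \<noteq> []"
    and runs: "\<And>e. e \<in> set es \<Longrightarrow> runs orc P (f e) \<delta> (W (f e)) T"
    and f: "\<And>s e. mreg s 1 = U \<Longrightarrow> mreg s 2 = u \<Longrightarrow> e \<in> set es \<Longrightarrow> mval e s = f e"
    and s: "mreg s 1 = U" "mreg s 2 = u" "sreg s 1 = of_real \<delta>"
  shows "\<exists>t s'. exec orc P (call_all es) s t s' \<and>
    wreg s' 1 = wreg s 1 @ concat (map (\<lambda>e. W (f e)) es) \<and>
    t \<le> 1 + sum_list (map mcost es) + length es * (6 + T + length (wreg s' 1))"
  using runs f s
proof (induction es arbitrary: s)
  case Nil
  show ?case by (auto intro!: exI exec.Skip)
next
  case (Cons e es)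
  define s1 where "s1 = s\<lparr>mreg := (mreg s)(0 := mval e s)\<rparr>"
  define s2 where "s2 = s1\<lparr>sreg := (sreg s1)(0 := sval (SReg 1) s1)\<rparr>"
  have e1: "exec orc P (SetM 0 e) s (1 + mcost e) s1" unfolding s1_def by (rule exec.SetM)
  have e2: "exec orc P (SetS 0 (SReg 1)) s1 (1 + scost (SReg 1 :: 'n sexp)) s2"
    unfolding s2_def by (rule exec.SetS)
  have "mval e s = f e" using Cons.prems by simp
  then have "mreg s2 0 = f e" "sreg s2 0 = of_real \<delta>"
    using Cons.prems by (simp_all add: s1_def s2_def)
  with exec_call[OF Cons.prems(1) P, of e s2]
  obtain t3 s3 where e3: "exec orc P (Call 0) s2 t3 s3" "t3 \<le> 1 + T" "wreg s3 0 = W (f e)"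
    and s3: "\<And>r. r \<noteq> 0 \<Longrightarrow> mreg s3 r = mreg s2 r" "\<And>r. r \<noteq> 0 \<Longrightarrow> sreg s3 r = sreg s2 r"
      "\<And>r. r \<noteq> 0 \<Longrightarrow> wreg s3 r = wreg s2 r"
    by auto
  define s4 where "s4 = s3\<lparr>wreg := (wreg s3)(1 := wreg s3 1 @ wreg s3 0)\<rparr>"
  have e4: "exec orc P (Append 1 1 0) s3 (1 + length (wreg s3 1 @ wreg s3 0)) s4"
    unfolding s4_def by (rule exec.Append) simp
  have s4: "mreg s4 1 = U" "mreg s4 2 = u" "sreg s4 1 = of_real \<delta>" "wreg s4 1 = wreg s 1 @ W (f e)"
    using s3 e3(3) Cons.prems by (simp_all add: s1_def s2_def s4_def)
  have r: "\<And>e. e \<in> set es \<Longrightarrow> runs orc P (f e) \<delta> (W (f e)) T" using Cons.prems(1) by simp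
  have f: "\<And>s e. mreg s 1 = U \<Longrightarrow> mreg s 2 = u \<Longrightarrow> e \<in> set es \<Longrightarrow> mval e s = f e"
    using Cons.prems(2) by simp
  obtain t5 s5 where e5: "exec orc P (call_all es) s4 t5 s5"
    "wreg s5 1 = wreg s4 1 @ concat (map (\<lambda>e. W (f e)) es)"
    "t5 \<le> 1 + sum_list (map mcost es) + length es * (6 + T + length (wreg s5 1))"
    using Cons.IH[OF r f s4(1-3)] by blast
  \<comment> \<open>Each intermediate word is a prefix of the final one, whose length therefore
    bounds the cost of every append.\<close>
  have len: "length (wreg s3 1 @ wreg s3 0) \<le> length (wreg s5 1)"
  proof -
    have "wreg s3 1 @ wreg s3 0 = wreg s4 1" by (simp add: s4_def)
    then show ?thesis unfolding e5(2) by simp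
  qed
  have "exec orc P (call_all (e # es)) s ((1 + mcost e) + ((1 + scost (SReg 1 :: 'n sexp)) +
      (t3 + ((1 + length (wreg s3 1 @ wreg s3 0)) + t5)))) s5"
    unfolding call_all.simps by (intro exec.Seq[OF e1] exec.Seq[OF e2] exec.Seq[OF e3(1)] exec.Seq[OF e4] e5(1))
  moreover have "(1 + mcost e) + ((1 + scost (SReg 1 :: 'n sexp)) +
      (t3 + ((1 + length (wreg s3 1 @ wreg s3 0)) + t5)))
      \<le> 1 + sum_list (map mcost (e # es)) + length (e # es) * (6 + T + length (wreg s5 1))"
    using e3(2) e5(3) len by simp
  moreover have "wreg s5 1 = wreg s 1 @ concat (map (\<lambda>e. W (f e)) (e # es))"
    using e5(2) s4(4) by simp
  ultimately show ?case by blast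
qed

text \<open>
  To reach precision \<open>\<delta>\<close>, the recursive calls ask for \<open>\<tau>\<^sup>2 = \<delta> powr (3 / 4)\<close>.  Then \<open>\<tau>\<^sup>3 = \<delta> powr (9 / 8)\<close>,
  and the spare factor \<open>\<delta> powr (1 / 8)\<close> absorbs the constant of the refinement step.
\<close>

definition three_quarters :: "'n sexp \<Rightarrow> 'n sexp" where
  "three_quarters x = SMul (SSqrt (SSqrt x)) (SMul (SSqrt (SSqrt x)) (SSqrt (SSqrt x)))"

lemma sval_three_quarters:
  assumes "sval x s = of_real \<delta>" "0 < \<delta>"
  shows "sval (three_quarters x) s = of_real (\<delta> powr (3 / 4))"
proof -
  have "sqrt (sqrt \<delta>) = \<delta> powr (1 / 4)" using assms(2) by (simp add: powr_half_sqrt[symmetric] powr_powr)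
  then have "csqrt (csqrt (of_real \<delta>)) = of_real (\<delta> powr (1 / 4))"
    using assms(2) by (simp add: csqrt_of_real del: csqrt_of_real_nonneg)
  then have "sval (three_quarters x) s = of_real (\<delta> powr (1 / 4) * (\<delta> powr (1 / 4) * \<delta> powr (1 / 4)))"
    by (simp only: three_quarters_def sval.simps assms(1) of_real_mult)
  also have "\<delta> powr (1 / 4) * (\<delta> powr (1 / 4) * \<delta> powr (1 / 4)) = \<delta> powr (3 / 4)"
    by (simp add: powr_add[symmetric])
  finally show ?thesis .
qed

text \<open>The approximation of the target is requested twice, once to be multiplied out into
  \<open>u\<close> and once as the last entry of the list; both calls return the same word.\<close>

definition refine_prog :: "'n mexp list \<Rightarrow> ('n, 'g) com" where
  "refine_prog es = Seq (SetM 1 (MReg 0)) (Seq (SetS 1 (three_quarters (SReg 0))) (Seq (SetS 0 (SReg 1))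
     (Seq (Call 0) (Seq (Multiply_Out 2 0) (Seq (SetW 1 []) (Seq (call_all es) (Copy 0 1)))))))"

text \<open>The precision itself drives the recursion, coarsening from call to call until the net
  suffices. The threshold is the reciprocal of an integer because it must be built from
  literals.\<close>

definition compiler :: "nat \<Rightarrow> 'n mexp list \<Rightarrow> ('n, 'g) com" where
  "compiler k es = If_Le (SInv (SInt (int k))) (SReg 0) (Query 0 (MReg 0)) (refine_prog es)"

text \<open>The only word literal is the empty one; all gates come from the oracle.\<close>

lemma gates_compiler: "gates (compiler k es) = {}"
proof -
  have "gates (call_all es) = {}" by (induction es) auto
  then show ?thesis by (simp add: compiler_def refine_prog_def)
qed

lemma compiler_query:
  fixes es :: "'n::finite mexp list"
  assumes "1 / real k \<le> \<delta>"
  shows "runs orc [compiler k es] U \<delta> (orc U) 6"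
  unfolding runs_def
proof (intro allI impI)
  fix s :: "'n state" assume s: "mreg s 0 = U" "sreg s 0 = complex_of_real \<delta>"
  have "Re (sval (SInv (SInt (int k))) s) \<le> Re (sval (SReg 0) s)"
    using assms s by (simp add: inverse_eq_divide Re_divide_of_nat)
  from exec.If_True[OF this exec.Query]
  show "\<exists>t s'. exec orc [compiler k es] ([compiler k es] ! 0) s t s' \<and> wreg s' 0 = orc U \<and> t \<le> 6"
    unfolding compiler_def by (fastforce simp: s compiler_def)
qed

text \<open>One \<open>T\<close> bounds both the time and the length of the recursive answers, since
  appending and multiplying out cost the length; this keeps the recurrence linear in
  \<open>T\<close>.\<close>

lemma compiler_refine:
  fixes es :: "'n::finite mexp list"
  assumes k: "\<delta> < 1 / real k" "0 < \<delta>"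
    and W: "\<And>V. V \<in> S \<Longrightarrow> runs orc [compiler k es] V (\<delta> powr (3 / 4)) (W V) T \<and> length (W V) \<le> T"
    and U: "U \<in> S"
    and f: "\<And>s e. mreg s 1 = U \<Longrightarrow> mreg s 2 = word_prod (W U) \<Longrightarrow> e \<in> set es \<Longrightarrow> mval e s = f e"
    and fS: "\<And>e. e \<in> set es \<Longrightarrow> f e \<in> S"
  shows "runs orc [compiler k es] U \<delta> (concat (map (\<lambda>e. W (f e)) es))
    (30 + 2 * T + sum_list (map mcost es) + length es * (6 + T + length es * T))"
    and "length (concat (map (\<lambda>e. W (f e)) es)) \<le> length es * T"
proof -
  have "(\<And>e. e \<in> set es' \<Longrightarrow> f e \<in> S) \<Longrightarrow> length (concat (map (\<lambda>e. W (f e)) es')) \<le> length es' * T" for es'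
    using W by (induction es') (auto intro!: add_mono)
  from this[OF fS] show len: "length (concat (map (\<lambda>e. W (f e)) es)) \<le> length es * T" .
  let ?P = "[compiler k es]"
  show "runs orc ?P U \<delta> (concat (map (\<lambda>e. W (f e)) es))
    (30 + 2 * T + sum_list (map mcost es) + length es * (6 + T + length es * T))"
    unfolding runs_def
  proof (intro allI impI)
    fix s :: "'n state" assume s: "mreg s 0 = U" "sreg s 0 = complex_of_real \<delta>"
    have test: "\<not> Re (sval (SInv (SInt (int k))) s) \<le> Re (sval (SReg 0) s)"
      using k s by (simp add: inverse_eq_divide)
    define s1 where "s1 = s\<lparr>mreg := (mreg s)(1 := mval (MReg 0) s)\<rparr>"
    define s2 where "s2 = s1\<lparr>sreg := (sreg s1)(1 := sval (three_quarters (SReg 0)) s1)\<rparr>"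
    define s3 where "s3 = s2\<lparr>sreg := (sreg s2)(0 := sval (SReg 1) s2)\<rparr>"
    have e1: "exec orc ?P (SetM 1 (MReg 0)) s (1 + mcost (MReg 0 :: 'n mexp)) s1"
      unfolding s1_def by (rule exec.SetM)
    have e2: "exec orc ?P (SetS 1 (three_quarters (SReg 0))) s1 (1 + scost (three_quarters (SReg 0) :: 'n sexp)) s2"
      unfolding s2_def by (rule exec.SetS)
    have e3: "exec orc ?P (SetS 0 (SReg 1)) s2 (1 + scost (SReg 1 :: 'n sexp)) s3"
      unfolding s3_def by (rule exec.SetS)
    have "sval (three_quarters (SReg 0)) s1 = of_real (\<delta> powr (3 / 4))"
      by (rule sval_three_quarters) (use s k in \<open>simp_all add: s1_def\<close>)
    then have s3: "mreg s3 0 = U" "sreg s3 0 = of_real (\<delta> powr (3 / 4))" "mreg s3 1 = U"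
      "sreg s3 1 = of_real (\<delta> powr (3 / 4))"
      using s by (simp_all add: s1_def s2_def s3_def)
    obtain t4 s4 where e4: "exec orc ?P (Call 0) s3 t4 s4" "t4 \<le> 1 + T" "wreg s4 0 = W U"
      and s4: "\<And>r. r \<noteq> 0 \<Longrightarrow> mreg s4 r = mreg s3 r" "\<And>r. r \<noteq> 0 \<Longrightarrow> sreg s4 r = sreg s3 r"
        "\<And>r. r \<noteq> 0 \<Longrightarrow> wreg s4 r = wreg s3 r"
      by (rule exec_call[OF conjunct1[OF W[OF U]] _ s3(1,2)]) auto
    define s5 where "s5 = s4\<lparr>mreg := (mreg s4)(2 := word_prod (wreg s4 0))\<rparr>"
    define s6 where "s6 = s5\<lparr>wreg := (wreg s5)(1 := [])\<rparr>"
    have e5: "exec orc ?P (Multiply_Out 2 0) s4 (1 + length (wreg s4 0)) s5"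
      unfolding s5_def by (rule exec.Multiply_Out)
    have e6: "exec orc ?P (SetW 1 []) s5 (1 + length ([] :: 'n cmat list)) s6"
      unfolding s6_def by (rule exec.SetW)
    have s6: "mreg s6 1 = U" "mreg s6 2 = word_prod (W U)" "sreg s6 1 = of_real (\<delta> powr (3 / 4))" "wreg s6 1 = []"
      using s3 s4 e4(3) by (simp_all add: s5_def s6_def)
    obtain t7 s7 where e7: "exec orc ?P (call_all es) s6 t7 s7"
      "wreg s7 1 = wreg s6 1 @ concat (map (\<lambda>e. W (f e)) es)"
      "t7 \<le> 1 + sum_list (map mcost es) + length es * (6 + T + length (wreg s7 1))"
      using exec_call_all[where es = es and W = W and f = f and T = T, OF _ _ f s6(1-3)] W fS by blast
    define s8 where "s8 = s7\<lparr>wreg := (wreg s7)(0 := wreg s7 1)\<rparr>"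
    have e8: "exec orc ?P (Copy 0 1) s7 1 s8"
      unfolding s8_def by (rule exec.Copy)
    let ?t = "(1 + mcost (MReg 0 :: 'n mexp)) + ((1 + scost (three_quarters (SReg 0) :: 'n sexp)) +
      ((1 + scost (SReg 1 :: 'n sexp)) + (t4 + ((1 + length (wreg s4 0)) + ((1 + length ([] :: 'n cmat list)) + (t7 + 1))))))"
    have "exec orc ?P (refine_prog es) s ?t s8"
      unfolding refine_prog_def
      by (intro exec.Seq[OF e1] exec.Seq[OF e2] exec.Seq[OF e3] exec.Seq[OF e4(1)] exec.Seq[OF e5]
          exec.Seq[OF e6] exec.Seq[OF e7(1)] e8)
    from exec.If_False[OF test this, of "Query 0 (MReg 0)"]
    have "exec orc ?P (?P ! 0) s (1 + scost (SInv (SInt (int k)) :: 'n sexp) + scost (SReg 0 :: 'n sexp) + ?t) s8"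
      by (simp add: compiler_def)
    moreover have "wreg s8 0 = concat (map (\<lambda>e. W (f e)) es)"
      using e7(2) s6(4) by (simp add: s8_def)
    moreover have "1 + scost (SInv (SInt (int k)) :: 'n sexp) + scost (SReg 0 :: 'n sexp) + ?t
        \<le> 30 + 2 * T + sum_list (map mcost es) + length es * (6 + T + length es * T)"
    proof -
      have "length es * (6 + T + length (wreg s7 1)) \<le> length es * (6 + T + length es * T)"
        using len e7(2) s6(4) by (intro mult_left_mono) auto
      moreover have "length (wreg s4 0) \<le> T" using e4(3) W[OF U] by simp
      ultimately show ?thesis
        using e4(2) e7(3) unfolding three_quarters_def scost.simps mcost.simps list.size by linarith
    qed
    ultimately show "\<exists>t s'. exec orc ?P (?P ! 0) s t s' \<and> wreg s' 0 = concat (map (\<lambda>e. W (f e)) es) \<and>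
        t \<le> 30 + 2 * T + sum_list (map mcost es) + length es * (6 + T + length es * T)"
      by blast
  qed
qed

section \<open>Words in the normed algebra and the existence of nets\<close>

lemma word_prod_simps [simp]: "word_prod [] = mat 1" "word_prod (g # w) = g ** word_prod w"
  by (simp_all add: word_prod_def)

lemma Mtx_mat_1: "Mtx (mat 1) = 1" and Mtx_mult: "Mtx (A ** B) = Mtx A * Mtx B"
  by (simp_all add: one_mtx_def times_mtx_def Mtx_inverse)

lemma Mtx_word_prod: "Mtx (word_prod w) = prod_list (map Mtx w)"
  by (induction w) (simp_all add: Mtx_mat_1 Mtx_mult)

lemma Mtx_word_prod_concat: "Mtx (word_prod (concat ws)) = prod_list (map (\<lambda>w. Mtx (word_prod w)) ws)"
  by (induction ws) (simp_all add: Mtx_word_prod Mtx_mat_1)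

lemma op_norm_diff: "op_norm (A - B) = norm (Mtx A - Mtx B)"
  by (simp add: norm_mtx.rep_eq minus_mtx.rep_eq Mtx_inverse)

lemma Mtx_su_iff: "Mtx A \<in> su \<longleftrightarrow> A \<in> SU"
  by (simp add: su_def Mtx_inverse)

lemma word_prod_SU: "set w \<subseteq> SU \<Longrightarrow> word_prod w \<in> SU"
  unfolding Mtx_su_iff[symmetric] Mtx_word_prod by (intro su_prod_list) (auto simp: Mtx_su_iff)

lemma bounded_SU: "bounded (SU :: 'n::finite cmat set)"
proof (rule boundedI)
  fix A :: "'n cmat" assume "A \<in> SU"
  then have "norm (Mtx A) \<le> 1" by (intro norm_su_le) (simp add: Mtx_su_iff)
  then have "norm (A $ i $ j) \<le> 1" for i j
    using norm_ent_le[of "Mtx A" i j] by (simp add: ent.rep_eq Mtx_inverse)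
  then have "norm (A $ i) \<le> (\<Sum>j\<in>(UNIV :: 'n set). 1)" for i
    by (intro order_trans[OF L2_set_le_sum[of UNIV "\<lambda>j. norm (A $ i $ j)", folded norm_vec_def]] sum_mono) auto
  then show "norm A \<le> (\<Sum>i\<in>(UNIV :: 'n set). \<Sum>j\<in>(UNIV :: 'n set). 1)"
    by (intro order_trans[OF L2_set_le_sum[of UNIV "\<lambda>i. norm (A $ i)", folded norm_vec_def]] sum_mono) auto
qed

lemma op_norm_le_norm: "op_norm A \<le> (real CARD('n))\<^sup>2 * norm A" for A :: "'n::finite cmat"
proof -
  have "norm (A $ i $ j) \<le> norm A" for i j
    using Finite_Cartesian_Product.norm_nth_le[of "A $ i" j] Finite_Cartesian_Product.norm_nth_le[of A i]
    by linarith
  then have "op_norm A \<le> (\<Sum>i\<in>(UNIV :: 'n set). \<Sum>j\<in>(UNIV :: 'n set). norm A)"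
    by (intro order_trans[OF op_norm_le_entries] sum_mono)
  then show ?thesis by (simp add: power2_eq_square)
qed

text \<open>The closure of \<open>SU\<close> is compact and consists of limits of word products, so
  finitely many balls around such products cover it.\<close>

lemma word_net_exists:
  fixes G :: "'n::finite cmat set"
  assumes dense: "densely_generates_SU G" and \<delta>: "0 < \<delta>"
  shows "\<exists>N. word_net \<delta> G N"
proof -
  \<comment> \<open>Closure and balls refer to the Euclidean norm; the squared dimension converts it
    to the operator norm.\<close>
  define r where "r = \<delta> / (real CARD('n))\<^sup>2"
  have r: "0 < r" using \<delta> by (simp add: r_def)
  let ?W = "word_prod ` lists G"
  have cover: "closure SU \<subseteq> (\<Union>w\<in>lists G. ball (word_prod w) r)"
  proof
    fix U assume "U \<in> closure (SU :: 'n cmat set)"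
    moreover have "closure SU \<subseteq> closure ?W"
      using dense unfolding densely_generates_SU_def by (simp add: closure_minimal)
    ultimately obtain V where "V \<in> ?W" "dist V U < r"
      using closure_approachable[of U ?W] r by blast
    then show "U \<in> (\<Union>w\<in>lists G. ball (word_prod w) r)" by auto
  qed
  have "compact (closure (SU :: 'n cmat set))" using bounded_SU by simp
  from compactE_image[OF this _ cover]
  obtain N where N: "N \<subseteq> lists G" "finite N" "closure SU \<subseteq> (\<Union>w\<in>N. ball (word_prod w) r)" by auto
  have "\<exists>w\<in>N. op_norm (word_prod w - U) \<le> \<delta>" if "U \<in> SU" for U
  proof -
    from that N(3) closure_subset[of SU] obtain w where w: "w \<in> N" "dist (word_prod w) U < r" by auto
    have "op_norm (word_prod w - U) \<le> (real CARD('n))\<^sup>2 * norm (word_prod w - U)"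
      by (rule op_norm_le_norm)
    also have "\<dots> \<le> (real CARD('n))\<^sup>2 * r" using w(2) by (intro mult_left_mono) (auto simp: dist_norm)
    also have "\<dots> = \<delta>" by (simp add: r_def)
    finally show ?thesis using w(1) by blast
  qed
  then show ?thesis using N unfolding word_net_def by blast
qed

section \<open>Correctness, length and running time\<close>

lemma powr_three_eighths:
  fixes \<delta> :: real
  assumes "0 < \<delta>"
  shows "(\<delta> powr (3 / 8))\<^sup>2 = \<delta> powr (3 / 4)" "(\<delta> powr (3 / 8)) ^ 3 = \<delta> powr (1 / 8) * \<delta>"
proof -
  show "(\<delta> powr (3 / 8))\<^sup>2 = \<delta> powr (3 / 4)"
    using assms by (simp add: powr_power)
  have "(\<delta> powr (3 / 8)) ^ 3 = \<delta> powr (1 / 8 + 1)"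
    using assms by (simp add: powr_power)
  also have "\<dots> = \<delta> powr (1 / 8) * \<delta>" unfolding powr_add using assms by simp
  finally show "(\<delta> powr (3 / 8)) ^ 3 = \<delta> powr (1 / 8) * \<delta>" .
qed

text \<open>The induction is on a bound \<open>n\<close> for the recursion depth. Each level
  multiplies cost and length by at most \<open>K\<close>, and \<open>B\<close> covers a query as
  well as the longest net word.\<close>

lemma compiler_correct:
  fixes G :: "'n::finite cmat set"
  assumes step: "\<And>\<tau> U A. 0 \<le> \<tau> \<Longrightarrow> \<tau> \<le> 1 \<Longrightarrow> U \<in> su \<Longrightarrow>
       (\<And>V. V \<in> su \<Longrightarrow> A V \<in> su \<and> norm (A V - V) \<le> \<tau>\<^sup>2) \<Longrightarrow>
       norm (prod_list (map A (step_targets U (A U))) - (U :: 'n mtx)) \<le> C * \<tau> ^ 3"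
    and k: "2 \<le> k" "C * (1 / real k) powr (1 / 8) \<le> 1" "0 < C"
    and es: "\<And>s. map (\<lambda>e. mval e s) es = map mat_of (step_targets (Mtx (mreg s 1)) (Mtx (mreg s 2)))"
    and orc: "net_oracle (1 / real k) N orc" and N: "N \<subseteq> lists G" "\<And>w. w \<in> N \<Longrightarrow> length w \<le> L"
    and G: "G \<subseteq> SU"
    and B: "B = L + 6" and K: "K = 32 + sum_list (map mcost es) + length es * (7 + length es)"
    and U: "U \<in> SU" and \<delta>: "0 < \<delta>" "(1 / real k) powr ((4 / 3) ^ n) \<le> \<delta>"
  shows "\<exists>w. runs orc [compiler k es] U \<delta> w (B * K ^ n) \<and> length w \<le> B * K ^ n \<and>
    set w \<subseteq> G \<and> op_norm (word_prod w - U) \<le> \<delta>"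
  using U \<delta>
proof (induction n arbitrary: U \<delta>)
  \<comment> \<open>Stated for every \<open>n\<close>, because coarse precisions stop the recursion
    before depth \<open>n\<close>.\<close>
  have query: "\<exists>w. runs orc [compiler k es] U \<delta> w (B * K ^ n) \<and> length w \<le> B * K ^ n \<and>
    set w \<subseteq> G \<and> op_norm (word_prod w - U) \<le> \<delta>" if "U \<in> SU" "1 / real k \<le> \<delta>" for U \<delta> n
  proof -
    have w: "orc U \<in> N" "op_norm (word_prod (orc U) - U) \<le> 1 / real k"
      using orc that(1) by (auto simp: net_oracle_def)
    have "1 \<le> K ^ n" using K by simp
    then have "B \<le> B * K ^ n" by simp
    then have BK: "6 \<le> B * K ^ n" "L \<le> B * K ^ n" using B by linarith+
    have "runs orc [compiler k es] U \<delta> (orc U) (B * K ^ n)"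
      by (rule runs_mono[OF compiler_query[OF that(2)] BK(1)])
    then show ?thesis using w that(2) N BK(2) by (meson in_lists_conv_set order_trans subsetD subsetI)
  qed
  {
    case 0
    then have "1 / real k \<le> \<delta>" using k(1) by simp
    from query[OF 0(1) this] show ?case .
  next
    case (Suc n)
    show ?case
    proof (cases "1 / real k \<le> \<delta>")
      case True
      then show ?thesis using query Suc.prems(1) by blast
    next
      case False
      let ?\<delta> = "\<delta> powr (3 / 4)" and ?T = "B * K ^ n"
      \<comment> \<open>The power 3/4 carries the precision bound of level \<open>Suc n\<close> to
        that of level \<open>n\<close>.\<close>
      have "(1 / real k) powr ((4 / 3) ^ n) = ((1 / real k) powr ((4 / 3) ^ Suc n)) powr (3 / 4)"
        by (simp add: powr_powr)
      also have "\<dots> \<le> ?\<delta>" using Suc.prems by (intro powr_mono2) auto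
      finally have "\<forall>V\<in>SU. \<exists>w. runs orc [compiler k es] V ?\<delta> w ?T \<and> length w \<le> ?T \<and>
          set w \<subseteq> G \<and> op_norm (word_prod w - V) \<le> ?\<delta>"
        using Suc.IH Suc.prems(2) by simp
      from bchoice[OF this] obtain W where W: "\<And>V. V \<in> SU \<Longrightarrow> runs orc [compiler k es] V ?\<delta> (W V) ?T"
        "\<And>V. V \<in> SU \<Longrightarrow> length (W V) \<le> ?T" "\<And>V. V \<in> SU \<Longrightarrow> set (W V) \<subseteq> G"
        "\<And>V. V \<in> SU \<Longrightarrow> op_norm (word_prod (W V) - V) \<le> ?\<delta>"
        by blast
      define u where "u = word_prod (W U)"
      \<comment> \<open>A sample state with \<open>U\<close> and \<open>u\<close> in registers 1 and
        2 names the value of each expression; all such states give the same value.\<close>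
      define s0 :: "'n state" where
        "s0 = \<lparr>mreg = (\<lambda>_. u)(1 := U), sreg = (\<lambda>_. 0), wreg = (\<lambda>_. [])\<rparr>"
      define f where "f = (\<lambda>e. mval e s0)"
      have f_map: "map f es = map mat_of (step_targets (Mtx U) (Mtx u))"
        using es[of s0] by (simp add: f_def s0_def)
      have f: "mval e s = f e" if "mreg s 1 = U" "mreg s 2 = u" "e \<in> set es" for s e
      proof -
        have "map (\<lambda>e. mval e s) es = map f es" using es[of s] that(1,2) f_map by simp
        then show ?thesis using that(3) by (simp add: map_eq_conv)
      qed
      have fS: "f e \<in> SU" if "e \<in> set es" for e
      proof -
        have "f e \<in> set (map mat_of (step_targets (Mtx U) (Mtx u)))"
          unfolding f_map[symmetric] using that by simp
        then obtain M where "f e = mat_of M" "M \<in> set (step_targets (Mtx U) (Mtx u))" by auto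
        moreover have "Mtx U \<in> su" using Suc.prems(1) by (simp add: Mtx_su_iff)
        ultimately have "M \<in> su" "f e = mat_of M" using set_step_targets by blast+
        then show ?thesis by (simp add: su_def)
      qed
      let ?w = "concat (map (\<lambda>e. W (f e)) es)"
      note refine = compiler_refine[where k = k and \<delta> = \<delta> and es = es and W = W and T = ?T and f = f
          and S = SU and orc = orc and U = U]
      have run: "runs orc [compiler k es] U \<delta> ?w
          (30 + 2 * ?T + sum_list (map mcost es) + length es * (6 + ?T + length es * ?T))"
        and len: "length ?w \<le> length es * ?T"
        using False Suc.prems W(1,2) f fS by (intro refine; simp add: u_def)+
      have T1: "1 \<le> ?T" using B K by simp
      \<comment> \<open>As \<open>?T\<close> is at least 1, additive constants may be multiplied by
        it; this explains 32 = 30 + 2 and 7 = 6 + 1 in \<open>K\<close>.\<close>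
      have "30 + 2 * ?T + sum_list (map mcost es) + length es * (6 + ?T + length es * ?T)
          \<le> 30 * ?T + 2 * ?T + sum_list (map mcost es) * ?T + length es * (6 * ?T + ?T + length es * ?T)"
        using T1 by (intro add_mono mult_left_mono) auto
      also have "\<dots> = B * K ^ Suc n" by (simp add: K algebra_simps)
      finally have "runs orc [compiler k es] U \<delta> ?w (B * K ^ Suc n)"
        by (rule runs_mono[OF run])
      moreover have "length ?w \<le> B * K ^ Suc n"
      proof -
        have "length es * 1 \<le> length es * (7 + length es)" by (rule mult_le_mono2) simp
        then have "length es \<le> K" unfolding K by linarith
        then have "length es * ?T \<le> K * ?T" by (rule mult_right_mono) simp
        with len have "length ?w \<le> K * ?T" by (rule order_trans)
        also have "K * ?T = B * K ^ Suc n" by (simp only: power_Suc mult.left_commute)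
        finally show ?thesis .
      qed
      moreover have "set ?w \<subseteq> G" using W(3) fS by auto
      moreover have "op_norm (word_prod ?w - U) \<le> \<delta>"
      proof -
        define A where "A = (\<lambda>V. Mtx (word_prod (W (mat_of V))))"
        let ?\<tau> = "\<delta> powr (3 / 8)"
        have "1 / real k < 1" using k(1) by simp
        then have "\<delta> < 1" using False by linarith
        then have \<tau>: "?\<tau> \<le> 1" using Suc.prems(2) by (simp add: powr_le1)
        have A: "A V \<in> su \<and> norm (A V - V) \<le> ?\<tau>\<^sup>2" if "V \<in> su" for V
        proof -
          have V: "mat_of V \<in> SU" using that by (simp add: su_def)
          then have "word_prod (W (mat_of V)) \<in> SU" using W(3) G by (intro word_prod_SU) blast
          moreover have "norm (A V - V) \<le> ?\<delta>"
            using W(4)[OF V] by (simp add: op_norm_diff A_def mat_of_inverse)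
          ultimately show ?thesis
            using powr_three_eighths(1)[OF Suc.prems(2)] by (simp add: A_def Mtx_su_iff)
        qed
        have "Mtx (word_prod ?w) = prod_list (map (\<lambda>M. Mtx (word_prod (W M))) (map f es))"
          by (simp add: Mtx_word_prod_concat o_def)
        also have "\<dots> = prod_list (map A (step_targets (Mtx U) (A (Mtx U))))"
          unfolding f_map by (simp add: A_def o_def u_def Mtx_inverse)
        finally have "op_norm (word_prod ?w - U) =
            norm (prod_list (map A (step_targets (Mtx U) (A (Mtx U)))) - Mtx U)"
          by (simp add: op_norm_diff)
        also have "\<dots> \<le> C * ?\<tau> ^ 3"
          using Suc.prems(1) by (intro step \<tau> A) (simp_all add: Mtx_su_iff)
        also have "\<dots> = C * \<delta> powr (1 / 8) * \<delta>"
          using powr_three_eighths(2)[OF Suc.prems(2)] by simp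
        \<comment> \<open>Below the threshold the spare power of \<open>\<delta>\<close> is at most
          that of \<open>1 / real k\<close>, which was chosen to absorb \<open>C\<close>.\<close>
        also have "\<dots> \<le> C * (1 / real k) powr (1 / 8) * \<delta>"
          using False Suc.prems(2) k(3) by (intro mult_right_mono mult_left_mono powr_mono2) auto
        also have "\<dots> \<le> \<delta>" using k(2) Suc.prems(2) mult_right_mono[of _ 1 \<delta>] by auto
        finally show ?thesis .
      qed
      ultimately show ?thesis by blast
    qed
  }
qed

text \<open>The least \<open>n\<close> with
  \<open>ln (1 / \<epsilon>) \<le> (4 / 3) ^ n * ln (real k)\<close> is taken. By minimality the
  preceding power of 4/3 is below the quotient of the logarithms, and raising it to
  \<open>log (4 / 3) (real K)\<close> turns the base into \<open>K\<close>. One factor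
  \<open>K\<close> pays for the last level.\<close>

lemma recursion_depth:
  fixes k K :: nat and \<epsilon> :: real
  assumes k: "2 \<le> k" and K: "1 \<le> K" and \<epsilon>: "0 < \<epsilon>"
  shows "\<exists>n. (1 / real k) powr ((4 / 3) ^ n) \<le> \<epsilon> \<and>
    (\<epsilon> < 1 / real k \<longrightarrow>
      real (K ^ n) \<le> real K * (1 / ln (real k)) powr log (4 / 3) (real K) * ln (1 / \<epsilon>) powr log (4 / 3) (real K))"
proof -
  let ?l = "ln (real k)" and ?L = "ln (1 / \<epsilon>)" and ?c = "log (4 / 3) (real K)"
  have l: "0 < ?l" using k by simp
  have ex: "\<exists>n. ?L \<le> (4 / 3) ^ n * ?l"
  proof -
    obtain n where "?L / ?l < (4 / 3) ^ n" using real_arch_pow[of "4 / 3" "?L / ?l"] by auto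
    then show ?thesis using l by (intro exI[of _ n]) (simp add: field_simps)
  qed
  define n where "n = (LEAST n. ?L \<le> (4 / 3) ^ n * ?l)"
  have n: "?L \<le> (4 / 3) ^ n * ?l" unfolding n_def by (rule LeastI_ex[OF ex])
  have "(1 / real k) powr ((4 / 3) ^ n) = exp (- ((4 / 3) ^ n * ?l))"
    using k by (simp add: powr_def ln_div)
  also have "\<dots> \<le> exp (- ?L)" using n by simp
  also have "\<dots> = \<epsilon>" using \<epsilon> by (simp add: ln_div)
  finally have 1: "(1 / real k) powr ((4 / 3) ^ n) \<le> \<epsilon>" .
  have "real (K ^ n) \<le> real K * (1 / ?l) powr ?c * ?L powr ?c" if small: "\<epsilon> < 1 / real k"
  proof -
    \<comment> \<open>Below the threshold the depth is positive, so there is a preceding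
      level.\<close>
    have "?l < ?L"
    proof -
      have "real k < 1 / \<epsilon>" using small \<epsilon> k by (simp add: field_simps)
      then show ?thesis using k \<epsilon> by (subst ln_less_cancel_iff) auto
    qed
    then obtain m where m: "n = Suc m" using n by (cases n) auto
    then have "\<not> ?L \<le> (4 / 3) ^ m * ?l" unfolding n_def by (metis lessI not_less_Least)
    then have "(4 / 3) ^ m \<le> ?L / ?l" using l by (simp add: field_simps)
    then have "((4 / 3) ^ m) powr ?c \<le> (?L / ?l) powr ?c"
      using K by (intro powr_mono2) auto
    moreover have "((4 / 3) ^ m) powr ?c = real K ^ m"
    proof -
      have "((4 / 3 :: real) ^ m) powr ?c = ((4 / 3) powr ?c) ^ m"
      proof -
        have "((4 / 3 :: real) ^ m) powr ?c = ((4 / 3) powr real m) powr ?c"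
          by (simp only: powr_realpow)
        also have "\<dots> = ((4 / 3) powr ?c) powr real m"
          by (simp only: powr_powr mult.commute)
        also have "\<dots> = ((4 / 3) powr ?c) ^ m" by (rule powr_realpow) simp
        finally show ?thesis .
      qed
      also have "(4 / 3) powr ?c = real K" using K by simp
      finally show ?thesis .
    qed
    moreover have "(?L / ?l) powr ?c = (1 / ?l) powr ?c * ?L powr ?c"
      using l \<open>?l < ?L\<close> by (simp add: powr_mult[symmetric])
    ultimately have "real K ^ m \<le> (1 / ?l) powr ?c * ?L powr ?c" by simp
    then show ?thesis using K by (simp add: m mult.assoc mult_left_mono)
  qed
  with 1 show ?thesis by blast
qed

theorem mainTheorem1:
  assumes "CARD('n::finite) \<ge> 2"
  shows "\<exists>\<epsilon>\<^sub>0>0. \<forall>G :: 'n cmat set.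
    finite G \<and> G \<subseteq> SU \<and> densely_generates_SU G \<longrightarrow>
      (\<exists>N. word_net \<epsilon>\<^sub>0 G N) \<and>
      (\<forall>N. word_net \<epsilon>\<^sub>0 G N \<longrightarrow>
        (\<exists>P. gate_program G P \<and> efficient_compiler \<epsilon>\<^sub>0 G N P))"
proof -
  obtain C where C: "0 < C"
    "\<And>\<tau> U A. 0 \<le> \<tau> \<Longrightarrow> \<tau> \<le> 1 \<Longrightarrow> U \<in> su \<Longrightarrow>
       (\<And>V. V \<in> su \<Longrightarrow> A V \<in> su \<and> norm (A V - V) \<le> \<tau>\<^sup>2) \<Longrightarrow>
       norm (prod_list (map A (step_targets U (A U))) - (U :: 'n mtx)) \<le> C * \<tau> ^ 3"
    by (rule step_targets_error) blast
  \<comment> \<open>Here \<open>k \<ge> C ^ 8\<close> makes the eighth root of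
    \<open>1 / real k\<close> cancel \<open>C\<close>, and \<open>k \<ge> 2\<close> keeps the net
    radius below 1 and \<open>ln (real k)\<close> positive. The gate set does not enter.\<close>
  define k where "k = max 2 (nat \<lceil>C ^ 8\<rceil>)"
  have k: "2 \<le> k" by (simp add: k_def)
  have Ck: "C * (1 / real k) powr (1 / 8) \<le> 1"
  proof -
    have "C ^ 8 \<le> real k" unfolding k_def by linarith
    then have "(C ^ 8) powr (1 / 8) \<le> real k powr (1 / 8)" using C(1) by (intro powr_mono2) auto
    moreover have "(C ^ 8) powr (1 / 8) = C"
    proof -
      have "C ^ 8 = C powr 8" using C(1) by simp
      then have "(C ^ 8) powr (1 / 8) = C powr (8 * (1 / 8))" by (simp only: powr_powr)
      then show ?thesis using C(1) by simp
    qed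
    ultimately show ?thesis using k by (simp add: powr_divide)
  qed
  obtain es where es: "\<And>s. map (\<lambda>e. mval e s) es = map mat_of (step_targets (Mtx (mreg s 1)) (Mtx (mreg s 2) :: 'n mtx))"
    using lexpressible_step_targets[where 'n = 'n] unfolding lexpressible_def by blast
  define K where "K = 32 + sum_list (map mcost es) + length es * (7 + length es)"
  have K1: "1 \<le> K" by (simp add: K_def)
  let ?P = "[compiler k es] :: ('n, 'n cmat) com list" and ?c = "log (4 / 3) (real K)"
  have "efficient_compiler (1 / real k) G N ?P"
    if G: "G \<subseteq> SU" and N: "word_net (1 / real k) G N" for G N
  proof -
    obtain L where L: "\<And>w. w \<in> N \<Longrightarrow> length w \<le> L"
      using N finite_nat_set_iff_bounded_le[of "length ` N"] by (auto simp: word_net_def)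
    have NG: "N \<subseteq> lists G" using N by (simp add: word_net_def)
    define B where "B = L + 6"
    \<comment> \<open>The factor 2 absorbs the unit cost of the outermost call. Only
      \<open>B\<close> depends on the net; the exponent depends on the dimension alone.\<close>
    let ?C = "2 * real B * (real K * (1 / ln (real k)) powr ?c)"
    have "\<exists>t w. outputs orc ?P U \<epsilon> t w \<and> set w \<subseteq> G \<and> op_norm (word_prod w - U) \<le> \<epsilon> \<and>
        (\<epsilon> < 1 / real k \<longrightarrow> real (length w) \<le> ?C * ln (1 / \<epsilon>) powr ?c \<and> real t \<le> ?C * ln (1 / \<epsilon>) powr ?c)"
      if orc: "net_oracle (1 / real k) N orc" and U: "U \<in> SU" and \<epsilon>: "0 < \<epsilon>" for orc U \<epsilon>
    proof -
      obtain n where n: "(1 / real k) powr ((4 / 3) ^ n) \<le> \<epsilon>"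
        and bound: "\<epsilon> < 1 / real k \<Longrightarrow>
          real (K ^ n) \<le> real K * (1 / ln (real k)) powr ?c * ln (1 / \<epsilon>) powr ?c"
        using recursion_depth[OF k K1 \<epsilon>] by blast
      obtain w where w: "runs orc ?P U \<epsilon> w (B * K ^ n)" "length w \<le> B * K ^ n" "set w \<subseteq> G"
        "op_norm (word_prod w - U) \<le> \<epsilon>"
        using compiler_correct[where C = C and k = k and es = es and N = N and G = G and L = L,
            OF C(2) k Ck C(1) es orc NG L G B_def K_def U \<epsilon> n]
        by blast
      obtain t s where t: "exec orc ?P (Call 0) (init_state U \<epsilon>) t s" "t \<le> 1 + B * K ^ n" "wreg s 0 = w"
        by (rule exec_call[OF w(1), of "init_state U \<epsilon>"]) (auto simp: init_state_def)
      have "1 \<le> B * K ^ n" by (simp add: B_def K_def)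
      then have "t \<le> 2 * (B * K ^ n)" using t(2) by linarith
      then have t2: "real t \<le> 2 * real B * real (K ^ n)"
        by (metis mult.assoc of_nat_le_iff of_nat_mult of_nat_numeral)
      have w2: "real (length w) \<le> 2 * real B * real (K ^ n)"
      proof -
        have "length w \<le> 2 * (B * K ^ n)" using w(2) by simp
        then show ?thesis by (metis mult.assoc of_nat_le_iff of_nat_mult of_nat_numeral)
      qed
      have "2 * real B * real (K ^ n) \<le> ?C * ln (1 / \<epsilon>) powr ?c" if "\<epsilon> < 1 / real k"
        using mult_left_mono[OF bound[OF that], of "2 * real B"] by (simp add: mult.assoc)
      then have "\<epsilon> < 1 / real k \<longrightarrow>
          real (length w) \<le> ?C * ln (1 / \<epsilon>) powr ?c \<and> real t \<le> ?C * ln (1 / \<epsilon>) powr ?c"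
        using t2 w2 order_trans by blast
      moreover have "outputs orc ?P U \<epsilon> t w" using t(1,3) unfolding outputs_def by blast
      ultimately show ?thesis using w(3,4) by blast
    qed
    moreover have "0 < 1 / real k" "1 / real k < 1" using k by simp_all
    ultimately show ?thesis unfolding efficient_compiler_def by blast
  qed
  moreover have "gate_program G ?P" for G by (simp add: gate_program_def gates_compiler)
  moreover have "0 < 1 / real k" using k by simp
  ultimately show ?thesis using word_net_exists by blast
qed

end
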